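(* Let $1\le r\le s$, let $A\in\mathbb{C}_r^{m\times n}$ and $\widetilde A=A+E\in\mathbb{C}_s^{m\times n}$ have generalized polar decompositions $A=QH$ and $\widetilde A=\widetilde Q\widetilde H$, and let $\sigma_1\ge\dots\ge\sigma_r>0$ and $\widetilde\sigma_1\ge\dots\ge\widetilde\sigma_s>0$ be the nonzero singular values of $A$ and $\widetilde A$. Put $F_{r,s}:=\sum_{j=1}^r\sigma_j^2+\sum_{j=1}^s\widetilde\sigma_j^2$ and $G_{r,r}:=\sum_{j=1}^r\sigma_j\widetilde\sigma_j$. Then $$\|H-\widetilde H\|_F\ge\sqrt{\frac{F_{r,s}-2G_{r,r}}{F_{r,s}+2G_{r,r}}}\;\|E\|_F .$$ Moreover the coefficient of $\|E\|_F$ is optimal: for given $m,n$ and given $\sigma_1\ge\dots\ge\sigma_r>0$, $\widetilde\sigma_1\ge\dots\ge\widetilde\sigma_s>0$ with $s\le\min(m,n)$, it cannot be replaced by any larger number so that the inequality still holds for all $A\in\mathbb{C}_r^{m\times n}$, $\widetilde A\in\mathbb{C}_s^{m\times n}$ with these nonzero singular values.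
   Context: $\mathbb{C}^{m\times n}_r$ denotes the set of complex $m\times n$ matrices of rank $r$; $\|\cdot\|_F$ is the Frobenius norm. For $A\in\mathbb{C}_r^{m\times n}$, the generalized polar decomposition is $A=QH$ with $Q\in\mathbb{C}_r^{m\times n}$ subunitary (a partial isometry) and $H\in\mathbb{C}_r^{n\times n}$ positive semidefinite, subject to $\mathcal R(Q^* )=\mathcal R(H)$ (column spaces), which makes it unique; in fact $H=|A|:=(A^*A)^{1/2}$. $Q$ is the subunitary polar factor and $H$ the positive polar factor. *)

theory Defs
  imports
    Jordan_Normal_Form.DL_Rank
    Jordan_Normal_Form.Schur_Decomposition
begin

definition mats_of_rank :: "nat \<Rightarrow> nat \<Rightarrow> nat \<Rightarrow> complex mat set" where
  "mats_of_rank m n r = {A \<in> carrier_mat m n. vec_space.rank m A = r}"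

definition frob_norm :: "complex mat \<Rightarrow> real" where
  "frob_norm A = sqrt (\<Sum>i<dim_row A. \<Sum>j<dim_col A. (cmod (A $$ (i, j)))\<^sup>2)"

definition euclid_norm :: "complex vec \<Rightarrow> real" where
  "euclid_norm v = sqrt (\<Sum>i<dim_vec v. (cmod (v $ i))\<^sup>2)"

text \<open>The order on \<^typ>\<open>complex\<close> is that of \<^theory>\<open>HOL-Library.Complex_Order\<close>:
  \<open>0 \<le> z\<close> says that \<open>z\<close> is real and nonnegative.\<close>

definition pos_semidef :: "nat \<Rightarrow> complex mat \<Rightarrow> bool" where
  "pos_semidef n H \<longleftrightarrow> H \<in> carrier_mat n n \<and> mat_adjoint H = H \<and>
     (\<forall>v \<in> carrier_vec n. 0 \<le> (H *\<^sub>v v) \<bullet>c v)"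

text \<open>A partial isometry is isometric on the orthogonal complement of its kernel,
  which is the column space of its adjoint.\<close>

definition subunitary :: "nat \<Rightarrow> nat \<Rightarrow> complex mat \<Rightarrow> bool" where
  "subunitary m n Q \<longleftrightarrow> Q \<in> carrier_mat m n \<and>
     (\<forall>v \<in> vec_space.col_space n (mat_adjoint Q). euclid_norm (Q *\<^sub>v v) = euclid_norm v)"

definition gen_polar_decomp ::
  "nat \<Rightarrow> nat \<Rightarrow> nat \<Rightarrow> complex mat \<Rightarrow> complex mat \<Rightarrow> complex mat \<Rightarrow> bool" where
  "gen_polar_decomp m n r A Q H \<longleftrightarrow> A = Q * H \<and>
     Q \<in> mats_of_rank m n r \<and> subunitary m n Q \<and>
     H \<in> mats_of_rank n n r \<and> pos_semidef n H \<and>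
     vec_space.col_space n (mat_adjoint Q) = vec_space.col_space n H"

text \<open>Listed in decreasing order and with multiplicity. The eigenvalues of the Gram matrix
  are real and nonnegative, so passing to real parts loses nothing.\<close>

definition nonzero_singular_values :: "complex mat \<Rightarrow> real list" where
  "nonzero_singular_values A = rev (sorted_list_of_multiset
     (filter_mset (\<lambda>x. x \<noteq> 0)
       (image_mset (\<lambda>z. sqrt (Re z)) (proots (char_poly (mat_adjoint A * A))))))"

definition F_sum :: "nat \<Rightarrow> nat \<Rightarrow> (nat \<Rightarrow> real) \<Rightarrow> (nat \<Rightarrow> real) \<Rightarrow> real" where
  "F_sum r s \<sigma> \<tau> = (\<Sum>j=1..r. (\<sigma> j)\<^sup>2) + (\<Sum>j=1..s. (\<tau> j)\<^sup>2)"

definition G_sum :: "nat \<Rightarrow> (nat \<Rightarrow> real) \<Rightarrow> (nat \<Rightarrow> real) \<Rightarrow> real" where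
  "G_sum r \<sigma> \<tau> = (\<Sum>j=1..r. \<sigma> j * \<tau> j)"

definition polar_coeff :: "nat \<Rightarrow> nat \<Rightarrow> (nat \<Rightarrow> real) \<Rightarrow> (nat \<Rightarrow> real) \<Rightarrow> real" where
  "polar_coeff r s \<sigma> \<tau> =
     sqrt ((F_sum r s \<sigma> \<tau> - 2 * G_sum r \<sigma> \<tau>) / (F_sum r s \<sigma> \<tau> + 2 * G_sum r \<sigma> \<tau>))"

end

theory Submission
  imports Defs
begin

text \<open>The estimate separates into two independent bounds, one for each side. Write \<open>\<langle>A, B\<rangle>\<close> for
the trace of \<open>A\<^sup>* B\<close>. Since \<open>\<parallel>A\<parallel>\<^sup>2\<close> is the sum of the squared singular values,
\<open>\<parallel>A - B\<parallel>\<^sup>2 = \<parallel>A\<parallel>\<^sup>2 + \<parallel>B\<parallel>\<^sup>2 - 2 Re \<langle>A, B\<rangle>\<close> shows that, with the singular values of both matrices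
prescribed, only \<open>Re \<langle>A, B\<rangle>\<close> can vary, and von Neumann's trace inequality
(\<open>von_neumann_trace_inequality\<close>) confines it to the interval from \<open>-G\<close> to \<open>G\<close>. Hence \<open>\<parallel>A - B\<parallel>\<^sup>2\<close> always
lies between \<open>F - 2G\<close> and \<open>F + 2G\<close> (\<open>frob_norm_diff_bounds\<close>). The positive polar factor \<open>H\<close> of
\<open>A\<close> satisfies \<open>H\<^sup>* H = A\<^sup>* A\<close> (\<open>polar_factor_gram\<close>), so it has the same singular values
as \<open>A\<close>, and both bounds are available: the upper one for the pair of given matrices, the lower one
for the pair of positive factors. The square root of their quotient is the claimed coefficient.

Both bounds are attained by the same pair: two rectangular diagonal matrices carrying the prescribed
singular values, the second one with a minus sign. The sign is absorbed by the subunitary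
factor, so the positive factors are aligned while the matrices themselves are opposed
(\<open>extremal_pair\<close>). This gives optimality.

For the trace inequality, the Gram matrix of each of the two matrices is diagonalized by a unitary
one (\<open>hermitian_diagonalization\<close>). In these bases the trace becomes a double sum of
\<open>\<sigma> i * \<tau> j * C i j * W j i\<close>, where \<open>C\<close> holds the inner products of the left singular vectors of one
matrix with those of the other and \<open>W\<close> is unitary. By Bessel's inequality and unitarity the numbers
\<open>(|C i j|\<^sup>2 + |W j i|\<^sup>2) / 2\<close> form a doubly substochastic matrix, and among those the double sum is
largest for the identity, because both sequences decrease (\<open>substochastic_sum_le\<close>).\<close>

section \<open>Adjoints and inner products in coordinates\<close>

lemma dim_mat_adjoint [simp]: "dim_row (mat_adjoint A) = dim_col A" "dim_col (mat_adjoint A) = dim_row A"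
  by (simp_all add: mat_adjoint_def)

lemma mat_adjoint_closed [simp]: "mat_adjoint A \<in> carrier_mat n m \<longleftrightarrow> A \<in> carrier_mat m n"
  by (metis carrier_matD carrier_matI dim_mat_adjoint)

lemma index_mat_adjoint [simp]:
  fixes A :: "complex mat"
  assumes "i < dim_col A" "j < dim_row A"
  shows "mat_adjoint A $$ (i, j) = cnj (A $$ (j, i))"
  using assms by (simp add: mat_adjoint_def mat_of_rows_def)

lemma index_mult_mat_sum:
  assumes "A \<in> carrier_mat m k" "B \<in> carrier_mat k n" "i < m" "j < n"
  shows "(A * B) $$ (i, j) = (\<Sum>l<k. A $$ (i, l) * B $$ (l, j))"
  using assms by (auto simp: scalar_prod_def atLeast0LessThan intro!: sum.cong)

lemma index_adjoint_mult:
  fixes A B :: "complex mat"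
  assumes "A \<in> carrier_mat k m" "B \<in> carrier_mat k n" "i < m" "j < n"
  shows "(mat_adjoint A * B) $$ (i, j) = (\<Sum>l<k. cnj (A $$ (l, i)) * B $$ (l, j))"
  using assms by (subst index_mult_mat_sum[of _ m k _ n]) auto

lemma mat_adjoint_adjoint [simp]: "mat_adjoint (mat_adjoint A) = (A :: complex mat)"
  by (rule eq_matI) auto

lemma mat_adjoint_mult:
  fixes A B :: "complex mat"
  assumes "A \<in> carrier_mat m k" "B \<in> carrier_mat k n"
  shows "mat_adjoint (A * B) = mat_adjoint B * mat_adjoint A"
proof (rule eq_matI)
  fix i j assume "i < dim_row (mat_adjoint B * mat_adjoint A)" "j < dim_col (mat_adjoint B * mat_adjoint A)"
  with assms have ij: "i < n" "j < m" by auto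
  have "mat_adjoint (A * B) $$ (i, j) = cnj ((A * B) $$ (j, i))"
    using assms ij by simp
  also have "\<dots> = (\<Sum>l<k. cnj (B $$ (l, i)) * mat_adjoint A $$ (l, j))"
    using assms ij by (subst index_mult_mat_sum[OF assms]) (auto simp: mult.commute intro!: sum.cong)
  also have "\<dots> = (mat_adjoint B * mat_adjoint A) $$ (i, j)"
    using assms ij by (subst index_adjoint_mult[of _ k n _ m]) auto
  finally show "mat_adjoint (A * B) $$ (i, j) = (mat_adjoint B * mat_adjoint A) $$ (i, j)" .
qed (use assms in auto)

lemma cscalar_prod_sum:
  fixes v w :: "complex vec"
  assumes "v \<in> carrier_vec n" "w \<in> carrier_vec n"
  shows "v \<bullet>c w = (\<Sum>k<n. v $ k * cnj (w $ k))"
  using assms by (auto simp: scalar_prod_def atLeast0LessThan intro!: sum.cong)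

section \<open>Unitary diagonalization of Hermitian matrices\<close>

text \<open>Gram-Schmidt, started from a basis that begins with \<open>v\<close>, keeps \<open>v\<close> in the first place; its output is
orthogonal but not normalized, which explains the factor \<open>c\<close>.\<close>
lemma unitary_with_first_column:
  fixes v :: "complex vec"
  assumes v: "v \<in> carrier_vec n" "v \<noteq> 0\<^sub>v n"
  shows "\<exists>W c. W \<in> carrier_mat n n \<and> mat_adjoint W * W = 1\<^sub>m n \<and> (\<forall>i<n. W $$ (i, 0) = c * v $ i)"
proof -
  interpret cof_vec_space n "TYPE(complex)" .
  define b where "b = basis_completion v"
  define ws where "ws = gram_schmidt n b"
  note b = basis_completion[OF v, folded b_def]
  from v have n: "n > 0" by (cases n) auto
  then obtain vs where bv: "b = v # vs" using b(6,7) by (cases b) auto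
  have ws: "set ws \<subseteq> carrier_vec n" "corthogonal ws" "length ws = n"
    using gram_schmidt_result[OF b(2,4,5) ws_def] b(6) by auto
  have hd: "ws ! 0 = v"
    using gram_schmidt_hd[OF v(1), of vs] ws(3) n by (cases ws) (auto simp: ws_def bv)
  define d where "d j = sqrt (Re (ws ! j \<bullet>c ws ! j))" for j
  define W where "W = mat n n (\<lambda>(i, j). ws ! j $ i / of_real (d j))"
  have wsc: "ws ! j \<in> carrier_vec n" if "j < n" for j using ws that by auto
  have d: "of_real (d j) * of_real (d j) = ws ! j \<bullet>c ws ! j" "d j \<noteq> 0" if "j < n" for j
  proof -
    have "ws ! j \<bullet>c ws ! j \<noteq> 0" using corthogonalD[OF ws(2)] that ws(3) by auto
    moreover have "0 \<le> ws ! j \<bullet>c ws ! j" by (rule conjugate_square_ge_0_vec)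
    ultimately have *: "Re (ws ! j \<bullet>c ws ! j) > 0" "ws ! j \<bullet>c ws ! j = of_real (Re (ws ! j \<bullet>c ws ! j))"
      by (auto simp: less_eq_complex_def complex_eq_iff)
    then show "of_real (d j) * of_real (d j) = ws ! j \<bullet>c ws ! j" "d j \<noteq> 0"
      using * by (auto simp: d_def simp flip: of_real_mult)
  qed
  have W: "W \<in> carrier_mat n n" by (simp add: W_def)
  have "mat_adjoint W * W = 1\<^sub>m n"
  proof (rule eq_matI)
    fix i j assume "i < dim_row (1\<^sub>m n :: complex mat)" "j < dim_col (1\<^sub>m n :: complex mat)"
    then have ij: "i < n" "j < n" by auto
    have "(mat_adjoint W * W) $$ (i, j) = (ws ! j \<bullet>c ws ! i) / (of_real (d i) * of_real (d j))"
      using ij unfolding index_adjoint_mult[OF W W ij] cscalar_prod_sum[OF wsc[OF ij(2)] wsc[OF ij(1)]] sum_divide_distrib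
      by (intro sum.cong) (auto simp: W_def)
    also have "\<dots> = 1\<^sub>m n $$ (i, j)"
      using ij d corthogonalD[OF ws(2), of j i] ws(3) by auto
    finally show "(mat_adjoint W * W) $$ (i, j) = 1\<^sub>m n $$ (i, j)" .
  qed (use W in auto)
  moreover have "\<forall>i<n. W $$ (i, 0) = inverse (of_real (d 0)) * v $ i"
    using n hd by (auto simp: W_def field_simps)
  ultimately show ?thesis using W by blast
qed

lemma unitary_right_inverse:
  fixes U :: "complex mat"
  assumes "U \<in> carrier_mat n n" "mat_adjoint U * U = 1\<^sub>m n"
  shows "U * mat_adjoint U = 1\<^sub>m n"
  using assms by (intro mat_mult_left_right_inverse[of "mat_adjoint U" n U]) auto

text \<open>Deflation: a unitary change of basis that begins with an eigenvector for the first listed root splits off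
that root, and by Hermitian symmetry the remaining part of the first row vanishes too, so that the
lower right block is again Hermitian. Taking the roots as a list lets the caller choose the
order in which the eigenvalues appear; decreasing order matters for the trace inequality.\<close>
lemma hermitian_diagonalization:
  fixes A :: "complex mat"
  assumes "A \<in> carrier_mat n n" "mat_adjoint A = A" "char_poly A = (\<Prod>e\<leftarrow>es. [:- e, 1:])"
  shows "\<exists>U\<in>carrier_mat n n. mat_adjoint U * U = 1\<^sub>m n \<and>
    mat_adjoint U * A * U = mat n n (\<lambda>(i, j). if i = j then es ! i else 0)"
  using assms
proof (induction es arbitrary: n A)
  case Nil
  with degree_monic_char_poly[of A n] have "n = 0" by auto
  then show ?case by (intro bexI[of _ "1\<^sub>m 0"]) auto
next
  case (Cons e es)
  note A = Cons.prems(1) and herm = Cons.prems(2) and cp = Cons.prems(3)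
  have mon: "monic (\<Prod>e\<leftarrow>es. [:- e, 1:])" by (rule monic_prod_list) auto
  have "degree (char_poly A) = Suc (degree (\<Prod>e\<leftarrow>es. [:- e, 1:]))"
    unfolding cp using mon by (simp del: mult_pCons_left) (subst degree_mult_eq, auto)
  with degree_monic_char_poly[OF A] obtain k where n: "n = Suc k" by (cases n) auto
  have "eigenvalue A e" unfolding eigenvalue_root_char_poly[OF A] cp by simp
  then obtain v where "eigenvector A v e" by (auto simp: eigenvalue_def)
  then have v: "v \<in> carrier_vec n" "v \<noteq> 0\<^sub>v n" and Av: "A *\<^sub>v v = e \<cdot>\<^sub>v v"
    using A by (auto simp: eigenvector_def)
  obtain W c where W: "W \<in> carrier_mat n n" and WW: "mat_adjoint W * W = 1\<^sub>m n"
    and W0: "\<And>i. i < n \<Longrightarrow> W $$ (i, 0) = c * v $ i"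
    using unitary_with_first_column[OF v] by blast
  note WW' = unitary_right_inverse[OF W WW]
  define A' where "A' = mat_adjoint W * A * W"
  have A': "A' \<in> carrier_mat n n" using W A by (simp add: A'_def)
  have AW0: "(A * W) $$ (i, 0) = e * W $$ (i, 0)" if "i < n" for i
  proof -
    have "(A * W) $$ (i, 0) = (\<Sum>l<n. A $$ (i, l) * (c * v $ l))"
      using that n W0 by (subst index_mult_mat_sum[OF A W]) auto
    also have "\<dots> = c * (A *\<^sub>v v) $ i"
      using that A v by (auto simp: scalar_prod_def atLeast0LessThan sum_distrib_left mult_ac intro!: sum.cong)
    also have "\<dots> = e * W $$ (i, 0)" using that v W0 by (simp add: Av)
    finally show ?thesis .
  qed
  have A'0: "A' $$ (i, 0) = (if i = 0 then e else 0)" if "i < n" for i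
  proof -
    have "A' = mat_adjoint W * (A * W)"
      unfolding A'_def using A W by (intro assoc_mult_mat[of _ n n _ n _ n]) auto
    then have "A' $$ (i, 0) = (\<Sum>l<n. cnj (W $$ (l, i)) * (A * W) $$ (l, 0))"
      using index_adjoint_mult[of W n n "A * W" n i 0] that n A W
      by (simp del: index_mult_mat sum.lessThan_Suc)
    also have "\<dots> = e * (mat_adjoint W * W) $$ (i, 0)"
      using that n by (subst index_adjoint_mult[OF W W]) (auto simp: AW0 sum_distrib_left mult_ac simp del: index_mult_mat sum.lessThan_Suc intro!: sum.cong)
    finally show ?thesis using that n by (simp add: WW)
  qed
  have herm': "mat_adjoint A' = A'"
    using A W herm by (simp add: A'_def mat_adjoint_mult[of _ n n _ n] assoc_mult_mat[of _ n n _ n _ n])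
  have A'0': "A' $$ (0, i) = (if i = 0 then e else 0)" if "i < n" for i
  proof (cases "i = 0")
    case False
    have "A' $$ (0, i) = mat_adjoint A' $$ (0, i)" by (simp only: herm')
    also have "\<dots> = cnj (A' $$ (i, 0))" using A' that n by auto
    finally show ?thesis using A'0[OF that] False by simp
  qed (use A'0 n in auto)
  define B where "B = mat k k (\<lambda>(i, j). A' $$ (Suc i, Suc j))"
  have B: "B \<in> carrier_mat k k" by (simp add: B_def)
  have block: "A' = four_block_mat (mat 1 1 (\<lambda>_. e)) (0\<^sub>m 1 k) (0\<^sub>m k 1) B"
    using A' n A'0 A'0' by (intro eq_matI) (auto simp: B_def)
  have hermB: "mat_adjoint B = B"
  proof (rule eq_matI)
    fix i j assume "i < dim_row B" "j < dim_col B"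
    then show "mat_adjoint B $$ (i, j) = B $$ (i, j)"
      using arg_cong[OF herm', of "\<lambda>M. M $$ (Suc i, Suc j)"] A' n by (auto simp: B_def)
  qed (auto simp: B_def)
  have "similar_mat_wit A' A (mat_adjoint W) W"
    by (rule similar_mat_witI[of _ _ n]) (use W A A' WW WW' in \<open>auto simp: A'_def\<close>)
  then have "char_poly A' = char_poly A"
    by (intro char_poly_similar) (auto simp: similar_mat_def)
  moreover have "char_poly A' = char_poly (mat 1 1 (\<lambda>_. e)) * char_poly B"
    unfolding block by (rule char_poly_four_block_zeros_col[OF _ _ B]) auto
  moreover have "char_poly (mat 1 1 (\<lambda>_. e)) = [:- e, 1:]"
    by (simp add: char_poly_defs det_def sign_def)
  ultimately have "[:- e, 1:] * char_poly B = [:- e, 1:] * (\<Prod>e\<leftarrow>es. [:- e, 1:])"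
    using cp by (simp del: mult_pCons_left)
  then have "char_poly B = (\<Prod>e\<leftarrow>es. [:- e, 1:])"
    by (simp del: mult_pCons_left)
  from Cons.IH[OF B hermB this] obtain V where V: "V \<in> carrier_mat k k"
    and VV: "mat_adjoint V * V = 1\<^sub>m k"
    and VBV: "mat_adjoint V * B * V = mat k k (\<lambda>(i, j). if i = j then es ! i else 0)" by blast
  define V' where "V' = four_block_mat (1\<^sub>m 1) (0\<^sub>m 1 k) (0\<^sub>m k 1) V"
  have V': "V' \<in> carrier_mat n n" using V n by (auto simp: V'_def)
  have adjV': "mat_adjoint V' = four_block_mat (1\<^sub>m 1) (0\<^sub>m 1 k) (0\<^sub>m k 1) (mat_adjoint V)"
    using V n by (intro eq_matI) (auto simp: V'_def)
  have VV': "mat_adjoint V' * V' = 1\<^sub>m n"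
    using V VV n unfolding adjV' unfolding V'_def
    by (subst mult_four_block_mat[of _ 1 1 _ k _ k _ _ 1 _ k]) (auto intro!: eq_matI)
  have VAV: "mat_adjoint V' * A' * V' = mat n n (\<lambda>(i, j). if i = j then (e # es) ! i else 0)"
  proof -
    have "mat_adjoint V' * A' = four_block_mat (mat 1 1 (\<lambda>_. e)) (0\<^sub>m 1 k) (0\<^sub>m k 1) (mat_adjoint V * B)"
      unfolding adjV' block using V B
      by (subst mult_four_block_mat[of _ 1 1 _ k _ k _ _ 1 _ k]) auto
    then have "mat_adjoint V' * A' * V' =
        four_block_mat (mat 1 1 (\<lambda>_. e)) (0\<^sub>m 1 k) (0\<^sub>m k 1) (mat_adjoint V * B * V)"
      using V B mult_carrier_mat[of "mat_adjoint V" k k B k] unfolding V'_def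
      by (simp, subst mult_four_block_mat[of _ 1 1 _ k _ k _ _ 1 _ k]) auto
    also have "\<dots> = mat n n (\<lambda>(i, j). if i = j then (e # es) ! i else 0)"
      unfolding VBV using n by (intro eq_matI) (auto simp: nth_Cons')
    finally show ?thesis .
  qed
  show ?case
  proof (intro bexI[of _ "W * V'"] conjI)
    show "W * V' \<in> carrier_mat n n" using W V' by simp
    have "mat_adjoint (W * V') * (W * V') = mat_adjoint V' * (mat_adjoint W * W) * V'"
      using W V' by (simp add: mat_adjoint_mult[of _ n n _ n] assoc_mult_mat[of _ n n _ n _ n])
    then show "mat_adjoint (W * V') * (W * V') = 1\<^sub>m n" using WW V' VV' by simp
    have "mat_adjoint (W * V') * A * (W * V') = mat_adjoint V' * A' * V'"
      using W V' A by (simp add: A'_def mat_adjoint_mult[of _ n n _ n] assoc_mult_mat[of _ n n _ n _ n])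
    then show "mat_adjoint (W * V') * A * (W * V') = mat n n (\<lambda>(i, j). if i = j then (e # es) ! i else 0)"
      using VAV by simp
  qed
qed

section \<open>Doubly substochastic weights and Bessel's inequality\<close>

text \<open>Weights of at most 1 with total at most \<open>k\<close> do best on the first \<open>k\<close> entries of a decreasing sequence.
Subtracting the threshold \<open>t (k - 1)\<close> makes the entries nonnegative up to that index and
nonpositive beyond it, so the bound holds term by term; the subtracted part is controlled by the total
weight.\<close>
lemma truncated_substochastic_sum_le:
  fixes t q :: "nat \<Rightarrow> real"
  assumes dec: "\<And>i j. i \<le> j \<Longrightarrow> j < n \<Longrightarrow> t j \<le> t i" and nonneg: "\<And>i. i < n \<Longrightarrow> 0 \<le> t i"
    and q: "\<And>j. j < n \<Longrightarrow> 0 \<le> q j" "\<And>j. j < n \<Longrightarrow> q j \<le> 1"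
    and total: "(\<Sum>j<n. q j) \<le> real k" and k: "0 < k" "k \<le> n"
  shows "(\<Sum>j<n. t j * q j) \<le> (\<Sum>j<k. t j)"
proof -
  define c where "c = t (k - 1)"
  have "(\<Sum>j<n. (t j - c) * q j) \<le> (\<Sum>j<n. if j < k then t j - c else 0)"
  proof (rule sum_mono)
    fix j assume "j \<in> {..<n}"
    then have j: "j < n" by simp
    show "(t j - c) * q j \<le> (if j < k then t j - c else 0)"
    proof (cases "j < k")
      case True
      then have "0 \<le> t j - c" using dec[of j "k - 1"] k by (simp add: c_def)
      then show ?thesis using True q(2)[OF j] mult_left_le[of "q j" "t j - c"] by simp
    next
      case False
      then have "t j - c \<le> 0" using dec[of "k - 1" j] j by (simp add: c_def)
      then show ?thesis using False q(1)[OF j] by (simp add: mult_nonpos_nonneg)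
    qed
  qed
  also have "\<dots> = (\<Sum>j\<in>{..<n} \<inter> {j. j < k}. t j - c)"
    by (simp add: sum.If_cases)
  also have "{..<n} \<inter> {j. j < k} = {..<k}" using k by auto
  also have "(\<Sum>j<k. t j - c) = (\<Sum>j<k. t j) - c * real k" by (simp add: sum_subtractf)
  finally have "(\<Sum>j<n. t j * q j) - c * (\<Sum>j<n. q j) \<le> (\<Sum>j<k. t j) - c * real k"
    by (simp add: left_diff_distrib sum_subtractf sum_distrib_left)
  moreover have "c * (\<Sum>j<n. q j) \<le> c * real k"
    using total nonneg[of "k - 1"] k by (intro mult_left_mono) (auto simp: c_def)
  ultimately show ?thesis by linarith
qed

text \<open>Summation by parts, phrased so that the induction carries the estimate of a partial sum
by its last coefficient times the partial sum of \<open>x\<close>.\<close>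
lemma abel_sum_nonpos:
  fixes s x :: "nat \<Rightarrow> real"
  assumes dec: "\<And>i j. i \<le> j \<Longrightarrow> j < n \<Longrightarrow> s j \<le> s i" and nonneg: "\<And>i. i < n \<Longrightarrow> 0 \<le> s i"
    and partial: "\<And>k. k \<le> n \<Longrightarrow> (\<Sum>i<k. x i) \<le> 0"
  shows "(\<Sum>i<n. s i * x i) \<le> 0"
proof -
  have "(\<Sum>i<Suc k. s i * x i) \<le> s k * (\<Sum>i<Suc k. x i)" if "k < n" for k
    using that
  proof (induction k)
    case (Suc k)
    have "s k * (\<Sum>i<Suc k. x i) \<le> s (Suc k) * (\<Sum>i<Suc k. x i)"
      using dec[of k "Suc k"] partial[of "Suc k"] Suc.prems by (intro mult_right_mono_neg) auto
    with Suc.IH Suc.prems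
    have "(\<Sum>i<Suc k. s i * x i) \<le> s (Suc k) * (\<Sum>i<Suc k. x i)" by linarith
    then show ?case
      using sum.lessThan_Suc[of "\<lambda>i. s i * x i" "Suc k"] sum.lessThan_Suc[of x "Suc k"]
      by (simp add: distrib_left)
  qed simp
  from this[of "n - 1"] have "(\<Sum>i<n. s i * x i) \<le> s (n - 1) * (\<Sum>i<n. x i)" if "n \<noteq> 0"
    using that by simp
  moreover have "s (n - 1) * (\<Sum>i<n. x i) \<le> 0" if "n \<noteq> 0"
    using that nonneg[of "n - 1"] partial[of n] by (intro mult_nonneg_nonpos) auto
  ultimately show ?thesis by (cases "n = 0") auto
qed

text \<open>Summation by parts in the first sequence reduces the claim to sums over the first \<open>k\<close> rows. The column
sums of these rows are weights of at most 1 with total at most \<open>k\<close>, which is the situation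
of the truncated bound.\<close>
lemma substochastic_sum_le:
  fixes s t :: "nat \<Rightarrow> real" and P :: "nat \<Rightarrow> nat \<Rightarrow> real"
  assumes s: "\<And>i j. i \<le> j \<Longrightarrow> j < n \<Longrightarrow> s j \<le> s i" "\<And>i. i < n \<Longrightarrow> 0 \<le> s i"
    and t: "\<And>i j. i \<le> j \<Longrightarrow> j < n \<Longrightarrow> t j \<le> t i" "\<And>i. i < n \<Longrightarrow> 0 \<le> t i"
    and P: "\<And>i j. i < n \<Longrightarrow> j < n \<Longrightarrow> 0 \<le> P i j"
    and rows: "\<And>i. i < n \<Longrightarrow> (\<Sum>j<n. P i j) \<le> 1"
    and cols: "\<And>j. j < n \<Longrightarrow> (\<Sum>i<n. P i j) \<le> 1"
  shows "(\<Sum>i<n. \<Sum>j<n. s i * t j * P i j) \<le> (\<Sum>i<n. s i * t i)"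
proof -
  have "(\<Sum>i<n. s i * ((\<Sum>j<n. t j * P i j) - t i)) \<le> 0"
  proof (rule abel_sum_nonpos[of n s, OF s])
    fix k assume k: "k \<le> n"
    show "(\<Sum>i<k. (\<Sum>j<n. t j * P i j) - t i) \<le> 0"
    proof (cases "k = 0")
      case False
      have "(\<Sum>i<k. \<Sum>j<n. t j * P i j) = (\<Sum>j<n. t j * (\<Sum>i<k. P i j))"
        by (subst sum.swap) (simp add: sum_distrib_left)
      also have "\<dots> \<le> (\<Sum>j<k. t j)"
      proof (rule truncated_substochastic_sum_le[of n t, OF t])
        fix j assume j: "j < n"
        show "0 \<le> (\<Sum>i<k. P i j)" using P j k by (intro sum_nonneg) auto
        have "(\<Sum>i<k. P i j) \<le> (\<Sum>i<n. P i j)" using P j k by (intro sum_mono2) auto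
        then show "(\<Sum>i<k. P i j) \<le> 1" using cols[OF j] by linarith
      next
        have "(\<Sum>j<n. \<Sum>i<k. P i j) = (\<Sum>i<k. \<Sum>j<n. P i j)" by (rule sum.swap)
        also have "\<dots> \<le> (\<Sum>i<k. 1)" using rows k by (intro sum_mono) auto
        finally show "(\<Sum>j<n. \<Sum>i<k. P i j) \<le> real k" by simp
      qed (use False k in auto)
      finally show ?thesis by (simp add: sum_subtractf)
    qed simp
  qed auto
  then show ?thesis
    by (simp add: right_diff_distrib sum_subtractf sum_distrib_left mult.assoc)
qed

text \<open>The vectors are orthogonal of norm at most 1, not exactly 1: normalizing the columns
that belong to a zero singular value yields zero vectors. The inequality survives because
the squared norm of the projection \<open>p\<close> can only decrease.\<close>
lemma bessel_inequality:
  fixes a :: "nat \<Rightarrow> complex" and b :: "nat \<Rightarrow> nat \<Rightarrow> complex"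
  assumes orth: "\<And>i j. i < n \<Longrightarrow> j < n \<Longrightarrow> i \<noteq> j \<Longrightarrow> (\<Sum>k<m. cnj (b i k) * b j k) = 0"
    and norm: "\<And>j. j < n \<Longrightarrow> (\<Sum>k<m. (cmod (b j k))\<^sup>2) \<le> 1"
  shows "(\<Sum>j<n. (cmod (\<Sum>k<m. cnj (b j k) * a k))\<^sup>2) \<le> (\<Sum>k<m. (cmod (a k))\<^sup>2)"
proof -
  define c where "c j = (\<Sum>k<m. cnj (b j k) * a k)" for j
  define p where "p k = (\<Sum>j<n. c j * b j k)" for k
  have ap: "(\<Sum>k<m. cnj (p k) * a k) = of_real (\<Sum>j<n. (cmod (c j))\<^sup>2)"
  proof -
    have "(\<Sum>k<m. cnj (p k) * a k) = (\<Sum>k<m. \<Sum>j<n. cnj (c j) * (cnj (b j k) * a k))"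
      by (simp add: p_def sum_distrib_left sum_distrib_right mult_ac)
    also have "\<dots> = (\<Sum>j<n. cnj (c j) * c j)"
      by (subst sum.swap) (simp add: c_def sum_distrib_left)
    also have "\<dots> = of_real (\<Sum>j<n. (cmod (c j))\<^sup>2)"
      unfolding of_real_sum by (intro sum.cong refl) (metis complex_norm_square mult.commute)
    finally show ?thesis .
  qed
  have pp: "(\<Sum>k<m. (cmod (p k))\<^sup>2) \<le> (\<Sum>j<n. (cmod (c j))\<^sup>2)"
  proof -
    have "of_real (\<Sum>k<m. (cmod (p k))\<^sup>2) = (\<Sum>k<m. cnj (p k) * p k)"
      unfolding of_real_sum by (intro sum.cong refl) (metis complex_norm_square mult.commute)
    also have "\<dots> = (\<Sum>k<m. \<Sum>i<n. \<Sum>j<n. cnj (c i) * c j * (cnj (b i k) * b j k))"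
      by (simp only: p_def cnj_sum sum_product) (simp add: mult_ac)
    also have "\<dots> = (\<Sum>i<n. \<Sum>j<n. \<Sum>k<m. cnj (c i) * c j * (cnj (b i k) * b j k))"
      by (subst sum.swap, subst (2) sum.swap) simp
    also have "\<dots> = (\<Sum>i<n. \<Sum>j<n. cnj (c i) * c j * (\<Sum>k<m. cnj (b i k) * b j k))"
      by (simp add: sum_distrib_left)
    also have "\<dots> = (\<Sum>i<n. \<Sum>j<n. if j = i then cnj (c i) * c i * (\<Sum>k<m. cnj (b i k) * b i k) else 0)"
      using orth by (intro sum.cong) auto
    also have "\<dots> = (\<Sum>i<n. cnj (c i) * c i * (\<Sum>k<m. cnj (b i k) * b i k))"
      by simp
    also have "\<dots> = of_real (\<Sum>i<n. (cmod (c i))\<^sup>2 * (\<Sum>k<m. (cmod (b i k))\<^sup>2))"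
      unfolding of_real_sum of_real_mult
      by (intro sum.cong refl arg_cong2[of _ _ _ _ "(*)"]) (metis complex_norm_square mult.commute)+
    finally have "(\<Sum>k<m. (cmod (p k))\<^sup>2) = (\<Sum>i<n. (cmod (c i))\<^sup>2 * (\<Sum>k<m. (cmod (b i k))\<^sup>2))"
      by (simp only: of_real_eq_iff)
    also have "\<dots> \<le> (\<Sum>j<n. (cmod (c j))\<^sup>2)"
      using norm by (intro sum_mono mult_left_le) auto
    finally show ?thesis .
  qed
  have "0 \<le> (\<Sum>k<m. (cmod (a k - p k))\<^sup>2)" by (simp add: sum_nonneg)
  also have "\<dots> = (\<Sum>k<m. (cmod (a k))\<^sup>2 + (cmod (p k))\<^sup>2 - 2 * Re (cnj (p k) * a k))"
    by (intro sum.cong refl) (simp only: cmod_power2, simp add: power2_eq_square algebra_simps)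
  also have "\<dots> = (\<Sum>k<m. (cmod (a k))\<^sup>2) + (\<Sum>k<m. (cmod (p k))\<^sup>2) - 2 * Re (\<Sum>k<m. cnj (p k) * a k)"
    by (simp only: sum.distrib sum_subtractf Re_sum sum_distrib_left)
  finally show ?thesis using pp unfolding ap Re_complex_of_real c_def by linarith
qed

section \<open>Singular values and Gram matrices\<close>

lemma adjoint_cscalar_prod:
  fixes A :: "complex mat"
  assumes "A \<in> carrier_mat m n" "w \<in> carrier_vec m" "v \<in> carrier_vec n"
  shows "(mat_adjoint A *\<^sub>v w) \<bullet>c v = w \<bullet>c (A *\<^sub>v v)"
proof -
  have "(mat_adjoint A *\<^sub>v w) \<bullet>c v = (\<Sum>j<n. \<Sum>i<m. cnj (A $$ (i, j)) * w $ i * cnj (v $ j))"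
    using assms by (subst cscalar_prod_sum[of _ n])
      (auto simp: mult_mat_vec_def scalar_prod_def atLeast0LessThan sum_distrib_right intro!: sum.cong)
  also have "\<dots> = w \<bullet>c (A *\<^sub>v v)"
    using assms by (subst sum.swap, subst cscalar_prod_sum[of _ m])
      (auto simp: mult_mat_vec_def scalar_prod_def atLeast0LessThan sum_distrib_left mult_ac intro!: sum.cong)
  finally show ?thesis .
qed

lemma gram_cscalar_prod:
  fixes A :: "complex mat"
  assumes "A \<in> carrier_mat m n" "v \<in> carrier_vec n"
  shows "(mat_adjoint A * A *\<^sub>v v) \<bullet>c v = (A *\<^sub>v v) \<bullet>c (A *\<^sub>v v)"
  using adjoint_cscalar_prod[of A m n "A *\<^sub>v v" v] assms
  by (simp add: assoc_mult_mat_vec[of _ n m _ n])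

lemma gram_char_poly_root_nonneg:
  fixes A :: "complex mat"
  assumes A: "A \<in> carrier_mat m n" and root: "poly (char_poly (mat_adjoint A * A)) z = 0"
  shows "0 \<le> z"
proof -
  have G: "mat_adjoint A * A \<in> carrier_mat n n" using A by simp
  obtain v where "eigenvector (mat_adjoint A * A) v z"
    using root eigenvalue_root_char_poly[OF G] by (auto simp: eigenvalue_def)
  then have v: "v \<in> carrier_vec n" "v \<noteq> 0\<^sub>v n" "mat_adjoint A * A *\<^sub>v v = z \<cdot>\<^sub>v v"
    using A by (auto simp: eigenvector_def)
  have *: "z * (v \<bullet>c v) = (A *\<^sub>v v) \<bullet>c (A *\<^sub>v v)"
    using gram_cscalar_prod[OF A v(1)] v by simp
  have "0 \<le> v \<bullet>c v" "0 \<le> (A *\<^sub>v v) \<bullet>c (A *\<^sub>v v)" by (rule conjugate_square_ge_0_vec)+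
  moreover have "v \<bullet>c v \<noteq> 0" using v by simp
  ultimately obtain x y where "v \<bullet>c v = of_real x" "x > 0" "(A *\<^sub>v v) \<bullet>c (A *\<^sub>v v) = of_real y" "y \<ge> 0"
    by (metis complex_is_Real_iff less_eq_complex_def of_real_0 of_real_Re order_less_le zero_complex.simps)
  with * have "z * of_real x = of_real y" "x > 0" "y \<ge> 0" by auto
  then have "z = of_real (y / x)" by (simp add: field_simps)
  then show ?thesis using \<open>x > 0\<close> \<open>y \<ge> 0\<close> by (simp add: less_eq_complex_def)
qed

text \<open>The 1-based list of nonzero singular values as a 0-based sequence extended by zeros, so that it
also lists the square roots of all eigenvalues of the Gram matrix.\<close>
definition padded_values :: "nat \<Rightarrow> (nat \<Rightarrow> real) \<Rightarrow> nat \<Rightarrow> real" where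
  "padded_values r \<sigma> j = (if j < r then \<sigma> (Suc j) else 0)"

lemma map_padded_values:
  assumes "r \<le> n"
  shows "map (padded_values r \<sigma>) [0..<n] = map \<sigma> [1..<Suc r] @ replicate (n - r) 0"
  using assms by (intro nth_equalityI) (auto simp: padded_values_def nth_append simp del: upt_Suc)

lemma proots_linear_factors:
  fixes as :: "'a :: idom list"
  shows "proots (\<Prod>a\<leftarrow>as. [:- a, 1:]) = mset as"
proof (induction as)
  case (Cons a as)
  have "(\<Prod>a\<leftarrow>as. [:- a, 1:]) \<noteq> 0" by (auto simp: prod_list_zero_iff)
  with Cons show ?case by (simp add: proots_mult del: mult_pCons_left)
qed simp

text \<open>The nonzero singular values determine the whole spectrum of the Gram matrix: its roots are real and
nonnegative, hence recovered by squaring, and those that were filtered out are zeros, whose number is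
fixed by the degree.\<close>
lemma char_poly_gram:
  fixes A :: "complex mat"
  assumes A: "A \<in> carrier_mat m n" and sv: "nonzero_singular_values A = map \<sigma> [1..<Suc r]"
  shows "r \<le> n" "char_poly (mat_adjoint A * A) =
    (\<Prod>e\<leftarrow>map (\<lambda>j. of_real ((padded_values r \<sigma> j)\<^sup>2)) [0..<n]. [:- e, 1:])"
proof -
  have "mat_adjoint A * A \<in> carrier_mat n n" using A by simp
  then obtain as where as: "char_poly (mat_adjoint A * A) = (\<Prod>a\<leftarrow>as. [:- a, 1:])" "length as = n"
    using char_poly_factorized by blast
  define L where "L = map (\<lambda>z. sqrt (Re z)) as"
  note proots_linear_factors[of as]
  then have "map \<sigma> [1..<Suc r] = rev (sorted_list_of_multiset (filter_mset (\<lambda>x. x \<noteq> 0) (mset L)))"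
    using sv by (simp add: nonzero_singular_values_def as L_def)
  then have msigma: "mset (map \<sigma> [1..<Suc r]) = filter_mset (\<lambda>x. x \<noteq> 0) (mset L)"
    by (simp only: mset_rev mset_sorted_list_of_multiset)
  have L: "mset L = mset (map \<sigma> [1..<Suc r]) + filter_mset (\<lambda>x. x = 0) (mset L)"
    unfolding msigma using multiset_partition[of "mset L" "\<lambda>x. x \<noteq> 0"] by simp
  have zeros: "filter_mset (\<lambda>x. x = 0) (mset L) = replicate_mset (count (mset L) 0) 0"
    by (simp add: filter_eq_replicate_mset)
  have "n = size (mset L)" using as by (simp add: L_def)
  also have "\<dots> = r + count (mset L) 0"
    by (subst L) (simp add: zeros del: upt_Suc)
  finally have n: "n = r + count (mset L) 0" .
  then show "r \<le> n" by simp
  have msL: "mset L = mset (map (padded_values r \<sigma>) [0..<n])"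
    using L zeros n by (simp add: map_padded_values del: upt_Suc)
  have asL: "as = map (\<lambda>x. of_real (x\<^sup>2)) L"
  proof (rule sym, unfold L_def map_map, rule map_idI)
    fix a assume "a \<in> set as"
    then have "poly (char_poly (mat_adjoint A * A)) a = 0"
      unfolding as poly_prod_list by (auto simp: prod_list_zero_iff)
    then have "0 \<le> a" by (rule gram_char_poly_root_nonneg[OF A])
    then show "((\<lambda>x. of_real (x\<^sup>2)) \<circ> (\<lambda>z. sqrt (Re z))) a = a"
      by (auto simp: less_eq_complex_def complex_eq_iff)
  qed
  have "mset as = mset (map (\<lambda>j. of_real ((padded_values r \<sigma> j)\<^sup>2)) [0..<n])"
    using arg_cong[OF msL, of "image_mset (\<lambda>x. complex_of_real (x\<^sup>2))"]
    unfolding asL by (simp add: multiset.map_comp comp_def)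
  then have "prod_mset (image_mset (\<lambda>e. [:- e, 1:]) (mset as)) =
    prod_mset (image_mset (\<lambda>e. [:- e, 1:]) (mset (map (\<lambda>j. of_real ((padded_values r \<sigma> j)\<^sup>2)) [0..<n])))"
    by (rule arg_cong)
  then show "char_poly (mat_adjoint A * A) =
    (\<Prod>e\<leftarrow>map (\<lambda>j. of_real ((padded_values r \<sigma> j)\<^sup>2)) [0..<n]. [:- e, 1:])"
    unfolding as(1) by (simp only: mset_map[symmetric] prod_mset_prod_list)
qed

text \<open>The essential part of a singular value decomposition: the columns of \<open>A * U\<close> are orthogonal and their
norms are the singular values. Dividing by the norms would give the left singular vectors.\<close>
lemma singular_frame:
  fixes A :: "complex mat"
  assumes A: "A \<in> carrier_mat m n" and sv: "nonzero_singular_values A = map \<sigma> [1..<Suc r]"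
  shows "\<exists>U\<in>carrier_mat n n. mat_adjoint U * U = 1\<^sub>m n \<and>
    mat_adjoint (A * U) * (A * U) =
      mat n n (\<lambda>(i, j). if i = j then of_real ((padded_values r \<sigma> i)\<^sup>2) else 0)"
proof -
  have G: "mat_adjoint A * A \<in> carrier_mat n n" using A by simp
  have "mat_adjoint (mat_adjoint A * A) = mat_adjoint A * A"
    using A by (simp add: mat_adjoint_mult[of _ n m _ n])
  from hermitian_diagonalization[OF G this char_poly_gram(2)[OF A sv]]
  obtain U where U: "U \<in> carrier_mat n n" "mat_adjoint U * U = 1\<^sub>m n"
    and D: "mat_adjoint U * (mat_adjoint A * A) * U = mat n n (\<lambda>(i, j). if i = j then
      map (\<lambda>j. of_real ((padded_values r \<sigma> j)\<^sup>2)) [0..<n] ! i else 0)" by blast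
  have "mat_adjoint (A * U) * (A * U) = (mat_adjoint U * mat_adjoint A) * (A * U)"
    using A U by (simp only: mat_adjoint_mult[of _ m n _ n])
  also have "\<dots> = mat_adjoint U * (mat_adjoint A * (A * U))"
    using A U by (intro assoc_mult_mat[of _ n n _ m _ n]) auto
  also have "mat_adjoint A * (A * U) = mat_adjoint A * A * U"
    using A U by (intro assoc_mult_mat[of _ n m _ n _ n, symmetric]) auto
  also have "mat_adjoint U * (mat_adjoint A * A * U) = mat_adjoint U * (mat_adjoint A * A) * U"
    using G U by (intro assoc_mult_mat[of _ n n _ n _ n, symmetric]) auto
  also have "\<dots> = mat n n (\<lambda>(i, j). if i = j then of_real ((padded_values r \<sigma> i)\<^sup>2) else 0)"
    unfolding D by (intro eq_matI) auto
  finally show ?thesis using U by blast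
qed

section \<open>The Frobenius norm and the trace\<close>

definition mat_trace :: "'a :: comm_monoid_add mat \<Rightarrow> 'a" where
  "mat_trace M = (\<Sum>i<dim_row M. M $$ (i, i))"

lemma mat_trace_comm:
  fixes A B :: "'a :: comm_semiring_0 mat"
  assumes "A \<in> carrier_mat m n" "B \<in> carrier_mat n m"
  shows "mat_trace (A * B) = mat_trace (B * A)"
proof -
  have "mat_trace (A * B) = (\<Sum>i<m. \<Sum>l<n. A $$ (i, l) * B $$ (l, i))"
    using assms by (auto simp: mat_trace_def index_mult_mat_sum[OF assms] simp del: index_mult_mat(1))
  also have "\<dots> = (\<Sum>l<n. \<Sum>i<m. B $$ (l, i) * A $$ (i, l))"
    by (subst sum.swap) (simp add: mult.commute)
  also have "\<dots> = mat_trace (B * A)"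
    using assms by (auto simp: mat_trace_def index_mult_mat_sum[OF assms(2,1)] simp del: index_mult_mat(1))
  finally show ?thesis .
qed

lemma mat_trace_adjoint_mult:
  fixes A B :: "complex mat"
  assumes "A \<in> carrier_mat m n" "B \<in> carrier_mat m n"
  shows "mat_trace (mat_adjoint A * B) = (\<Sum>i<m. \<Sum>j<n. cnj (A $$ (i, j)) * B $$ (i, j))"
  using assms
  by (subst sum.swap) (auto simp: mat_trace_def index_adjoint_mult[OF assms] simp del: index_mult_mat(1))

lemma frob_norm_nonneg: "0 \<le> frob_norm A"
  by (simp add: frob_norm_def sum_nonneg)

lemma frob_norm_squared:
  assumes "A \<in> carrier_mat m n"
  shows "(frob_norm A)\<^sup>2 = (\<Sum>i<m. \<Sum>j<n. (cmod (A $$ (i, j)))\<^sup>2)"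
  using assms by (simp add: frob_norm_def sum_nonneg)

lemma frob_norm_squared_trace:
  assumes "A \<in> carrier_mat m n"
  shows "of_real ((frob_norm A)\<^sup>2) = mat_trace (mat_adjoint A * A)"
  unfolding frob_norm_squared[OF assms] mat_trace_adjoint_mult[OF assms assms] of_real_sum
  by (intro sum.cong refl) (metis complex_norm_square mult.commute)

lemma frob_norm_diff_squared:
  assumes A: "A \<in> carrier_mat m n" and B: "B \<in> carrier_mat m n"
  shows "(frob_norm (A - B))\<^sup>2 = (frob_norm A)\<^sup>2 + (frob_norm B)\<^sup>2 - 2 * Re (mat_trace (mat_adjoint A * B))"
proof -
  have "(frob_norm (A - B))\<^sup>2 = (\<Sum>i<m. \<Sum>j<n. (cmod (A $$ (i, j) - B $$ (i, j)))\<^sup>2)"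
    using A B by (subst frob_norm_squared[of _ m n]) (auto intro!: sum.cong minus_carrier_mat)
  also have "\<dots> = (\<Sum>i<m. \<Sum>j<n. (cmod (A $$ (i, j)))\<^sup>2 + (cmod (B $$ (i, j)))\<^sup>2
      - 2 * Re (cnj (A $$ (i, j)) * B $$ (i, j)))"
    by (intro sum.cong refl) (simp only: cmod_power2, simp add: power2_eq_square algebra_simps)
  also have "\<dots> = (frob_norm A)\<^sup>2 + (frob_norm B)\<^sup>2 - 2 * Re (mat_trace (mat_adjoint A * B))"
    by (simp only: frob_norm_squared[OF A] frob_norm_squared[OF B] mat_trace_adjoint_mult[OF A B]
        sum.distrib sum_subtractf Re_sum sum_distrib_left)
  finally show ?thesis .
qed

lemma mat_trace_unitary_invariant:
  fixes A B :: "complex mat"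
  assumes A: "A \<in> carrier_mat m n" and B: "B \<in> carrier_mat m n"
    and U: "U \<in> carrier_mat n n" "mat_adjoint U * U = 1\<^sub>m n"
  shows "mat_trace (mat_adjoint (A * U) * (B * U)) = mat_trace (mat_adjoint A * B)"
proof -
  have AB: "mat_adjoint A * B \<in> carrier_mat n n" using A B by simp
  have "mat_adjoint (A * U) * (B * U) = mat_adjoint U * (mat_adjoint A * B * U)"
    using A B U by (simp add: mat_adjoint_mult[of _ m n _ n] assoc_mult_mat[of _ n n _ m _ n] assoc_mult_mat[of _ n m _ n _ n])
  also have "mat_trace \<dots> = mat_trace (mat_adjoint A * B * U * mat_adjoint U)"
    using AB U by (intro mat_trace_comm[of _ n n]) auto
  also have "mat_adjoint A * B * U * mat_adjoint U = mat_adjoint A * B"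
    using AB U unitary_right_inverse[OF U] right_mult_one_mat[OF AB] by (simp add: assoc_mult_mat[of _ n n _ n _ n])
  finally show ?thesis .
qed

text \<open>The summand may depend on the index as well, which serves sums of products of two
singular value sequences.\<close>
lemma sum_padded_values:
  assumes "r \<le> n"
  shows "(\<Sum>j<n. f j (padded_values r \<sigma> j)) = (\<Sum>j=1..r. f (j - 1) (\<sigma> j)) + (\<Sum>j=r..<n. f j 0)"
proof -
  have "(\<Sum>j<n. f j (padded_values r \<sigma> j)) =
    (\<Sum>j=0..<r. f j (padded_values r \<sigma> j)) + (\<Sum>j=r..<n. f j (padded_values r \<sigma> j))"
    using assms by (simp add: lessThan_atLeast0 sum.atLeastLessThan_concat)
  also have "(\<Sum>j=0..<r. f j (padded_values r \<sigma> j)) = (\<Sum>j=0..<r. f (Suc j - 1) (\<sigma> (Suc j)))"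
    by (intro sum.cong) (auto simp: padded_values_def)
  also have "\<dots> = (\<Sum>j=1..<Suc r. f (j - 1) (\<sigma> j))"
    by (simp only: One_nat_def sum.shift_bounds_Suc_ivl)
  also have "(\<Sum>j=r..<n. f j (padded_values r \<sigma> j)) = (\<Sum>j=r..<n. f j 0)"
    by (intro sum.cong) (auto simp: padded_values_def)
  finally show ?thesis by (simp add: atLeastLessThanSuc_atLeastAtMost)
qed

lemma frob_norm_squared_singular_values:
  assumes A: "A \<in> carrier_mat m n" and sv: "nonzero_singular_values A = map \<sigma> [1..<Suc r]"
  shows "(frob_norm A)\<^sup>2 = (\<Sum>j=1..r. (\<sigma> j)\<^sup>2)"
proof -
  obtain U where U: "U \<in> carrier_mat n n" "mat_adjoint U * U = 1\<^sub>m n"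
    and D: "mat_adjoint (A * U) * (A * U) =
      mat n n (\<lambda>(i, j). if i = j then of_real ((padded_values r \<sigma> i)\<^sup>2) else 0)"
    using singular_frame[OF A sv] by blast
  have "complex_of_real ((frob_norm A)\<^sup>2) = mat_trace (mat_adjoint (A * U) * (A * U))"
    by (simp only: frob_norm_squared_trace[OF A] mat_trace_unitary_invariant[OF A A U])
  also have "\<dots> = of_real (\<Sum>j<n. (padded_values r \<sigma> j)\<^sup>2)"
    unfolding D by (simp add: mat_trace_def)
  finally show ?thesis
    using sum_padded_values[OF char_poly_gram(1)[OF A sv], of "\<lambda>_ x. x\<^sup>2" \<sigma>] by (simp only: of_real_eq_iff) simp
qed

section \<open>Von Neumann's trace inequality\<close>

text \<open>A column with \<open>s i = 0\<close> has norm zero and is replaced by the zero vector, in accordance with division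
by zero; this is why the norms are only bounded by 1.\<close>
lemma normalized_columns:
  fixes X :: "complex mat" and s :: "nat \<Rightarrow> real"
  assumes X: "X \<in> carrier_mat m n"
    and gram: "mat_adjoint X * X = mat n n (\<lambda>(i, j). if i = j then of_real ((s i)\<^sup>2) else 0)"
    and a_def: "\<And>i k. a i k = X $$ (k, i) / of_real (s i)"
  shows "i < n \<Longrightarrow> k < m \<Longrightarrow> X $$ (k, i) = of_real (s i) * a i k"
    and "i < n \<Longrightarrow> j < n \<Longrightarrow> i \<noteq> j \<Longrightarrow> (\<Sum>k<m. cnj (a i k) * a j k) = 0"
    and "i < n \<Longrightarrow> (\<Sum>k<m. (cmod (a i k))\<^sup>2) \<le> 1"
proof -
  have inner: "(\<Sum>k<m. cnj (X $$ (k, i)) * X $$ (k, j)) = (if i = j then of_real ((s i)\<^sup>2) else 0)"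
    if "i < n" "j < n" for i j
    using that index_adjoint_mult[OF X X that] by (simp only: gram index_mat split)
  have norm: "(\<Sum>k<m. (cmod (X $$ (k, i)))\<^sup>2) = (s i)\<^sup>2" if "i < n" for i
  proof -
    have "complex_of_real (\<Sum>k<m. (cmod (X $$ (k, i)))\<^sup>2) = (\<Sum>k<m. cnj (X $$ (k, i)) * X $$ (k, i))"
      unfolding of_real_sum by (intro sum.cong refl) (metis complex_norm_square mult.commute)
    then show ?thesis using inner[OF that that] by (simp only: if_True refl of_real_eq_iff)
  qed
  show "X $$ (k, i) = of_real (s i) * a i k" if "i < n" "k < m"
  proof (cases "s i = 0")
    case True
    then have "(\<Sum>k<m. (cmod (X $$ (k, i)))\<^sup>2) = 0" using norm[OF that(1)] by simp
    then show ?thesis using that True by (simp add: sum_nonneg_eq_0_iff)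
  qed (simp add: a_def)
  show "(\<Sum>k<m. cnj (a i k) * a j k) = 0" if "i < n" "j < n" "i \<noteq> j"
  proof -
    have "(\<Sum>k<m. cnj (a i k) * a j k) = (\<Sum>k<m. cnj (X $$ (k, i)) * X $$ (k, j)) / (of_real (s i) * of_real (s j))"
      by (simp add: a_def sum_divide_distrib)
    then show ?thesis using inner that by simp
  qed
  show "(\<Sum>k<m. (cmod (a i k))\<^sup>2) \<le> 1" if "i < n"
  proof -
    have "(\<Sum>k<m. (cmod (a i k))\<^sup>2) = (\<Sum>k<m. (cmod (X $$ (k, i)))\<^sup>2) / (s i)\<^sup>2"
      by (simp add: a_def norm_divide power_divide sum_divide_distrib)
    also have "\<dots> \<le> 1" unfolding norm[OF that] by simp
    finally show ?thesis .
  qed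
qed

lemma unitary_row_sums:
  fixes W :: "complex mat"
  assumes W: "W \<in> carrier_mat n n" "mat_adjoint W * W = 1\<^sub>m n"
  shows "j < n \<Longrightarrow> (\<Sum>i<n. (cmod (W $$ (i, j)))\<^sup>2) = 1"
    and "i < n \<Longrightarrow> (\<Sum>j<n. (cmod (W $$ (i, j)))\<^sup>2) = 1"
proof -
  have *: "(\<Sum>i<n. (cmod (W $$ (i, j)))\<^sup>2) = 1"
    if "W \<in> carrier_mat n n" "mat_adjoint W * W = 1\<^sub>m n" "j < n" for W :: "complex mat" and j
  proof -
    have "complex_of_real (\<Sum>i<n. (cmod (W $$ (i, j)))\<^sup>2) = (\<Sum>i<n. cnj (W $$ (i, j)) * W $$ (i, j))"
      unfolding of_real_sum by (intro sum.cong refl) (metis complex_norm_square mult.commute)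
    also have "\<dots> = 1" using that index_adjoint_mult[of W n n W n j j] by simp
    finally show ?thesis by (simp only: of_real_eq_1_iff)
  qed
  show "j < n \<Longrightarrow> (\<Sum>i<n. (cmod (W $$ (i, j)))\<^sup>2) = 1" using *[OF W] .
  show "(\<Sum>j<n. (cmod (W $$ (i, j)))\<^sup>2) = 1" if "i < n"
  proof -
    have "(\<Sum>j<n. (cmod (W $$ (i, j)))\<^sup>2) = (\<Sum>j<n. (cmod (mat_adjoint W $$ (j, i)))\<^sup>2)"
      using W that by (intro sum.cong) auto
    also have "\<dots> = 1" using W that unitary_right_inverse[OF W] by (intro *) auto
    finally show ?thesis .
  qed
qed

text \<open>With \<open>X = A * U\<close> and \<open>Y = B * V\<close> the singular frames and \<open>W = V\<^sup>* U\<close> the passage between them, the trace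
of \<open>A\<^sup>* B\<close> is that of \<open>X\<^sup>* Y W\<close>. The product of an entry of the normalized \<open>X\<^sup>* Y\<close> and an entry of \<open>W\<close>
is at most the mean of their squares, which is doubly substochastic.\<close>
theorem von_neumann_trace_inequality:
  fixes A B :: "complex mat"
  assumes A: "A \<in> carrier_mat m n" and B: "B \<in> carrier_mat m n"
    and svA: "nonzero_singular_values A = map \<sigma> [1..<Suc r]"
    and svB: "nonzero_singular_values B = map \<tau> [1..<Suc s]"
    and rs: "r \<le> s"
    and \<sigma>: "\<forall>j\<in>{1..r}. 0 < \<sigma> j" "\<forall>i\<in>{1..r}. \<forall>j\<in>{1..r}. i \<le> j \<longrightarrow> \<sigma> j \<le> \<sigma> i"
    and \<tau>: "\<forall>j\<in>{1..s}. 0 < \<tau> j" "\<forall>i\<in>{1..s}. \<forall>j\<in>{1..s}. i \<le> j \<longrightarrow> \<tau> j \<le> \<tau> i"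
  shows "cmod (mat_trace (mat_adjoint A * B)) \<le> G_sum r \<sigma> \<tau>"
proof -
  define p where "p = padded_values r \<sigma>"
  define q where "q = padded_values s \<tau>"
  have p: "i \<le> j \<Longrightarrow> p j \<le> p i" "0 \<le> p i" for i j
    using \<sigma> by (auto simp: p_def padded_values_def less_imp_le)
  have q: "i \<le> j \<Longrightarrow> q j \<le> q i" "0 \<le> q i" for i j
    using \<tau> by (auto simp: q_def padded_values_def less_imp_le)
  obtain U where U: "U \<in> carrier_mat n n" "mat_adjoint U * U = 1\<^sub>m n"
    and gX: "mat_adjoint (A * U) * (A * U) = mat n n (\<lambda>(i, j). if i = j then of_real ((p i)\<^sup>2) else 0)"
    using singular_frame[OF A svA] unfolding p_def by blast
  obtain V where V: "V \<in> carrier_mat n n" "mat_adjoint V * V = 1\<^sub>m n"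
    and gY: "mat_adjoint (B * V) * (B * V) = mat n n (\<lambda>(i, j). if i = j then of_real ((q i)\<^sup>2) else 0)"
    using singular_frame[OF B svB] unfolding q_def by blast
  define X where "X = A * U"
  define Y where "Y = B * V"
  define W where "W = mat_adjoint V * U"
  have X: "X \<in> carrier_mat m n" and Y: "Y \<in> carrier_mat m n" and W: "W \<in> carrier_mat n n"
    using A B U V by (auto simp: X_def Y_def W_def)
  note VV = unitary_right_inverse[OF V]
  have WW: "mat_adjoint W * W = 1\<^sub>m n"
  proof -
    have "mat_adjoint W * W = mat_adjoint U * (V * mat_adjoint V) * U"
      using U V by (simp add: W_def mat_adjoint_mult[of _ n n _ n] assoc_mult_mat[of _ n n _ n _ n])
    then show ?thesis using U by (simp add: VV)
  qed
  have BU: "B * U = Y * W"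
  proof -
    have "Y * W = B * (V * mat_adjoint V) * U"
      using B U V by (simp add: W_def Y_def assoc_mult_mat[of _ m n _ n _ n] assoc_mult_mat[of _ n n _ n _ n])
    then show ?thesis using B by (simp add: VV)
  qed
  define a where "a i k = X $$ (k, i) / of_real (p i)" for i k
  define b where "b j k = Y $$ (k, j) / of_real (q j)" for j k
  define C where "C i j = (\<Sum>k<m. cnj (a i k) * b j k)" for i j
  note a = normalized_columns[OF X gX[folded X_def] a_def]
  note b = normalized_columns[OF Y gY[folded Y_def] b_def]
  have XY: "(mat_adjoint X * Y) $$ (i, j) = of_real (p i) * of_real (q j) * C i j" if "i < n" "j < n" for i j
    using that a(1)[OF that(1)] b(1)[OF that(2)] unfolding index_adjoint_mult[OF X Y that] C_def sum_distrib_left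
    by (intro sum.cong) auto
  have "mat_trace (mat_adjoint A * B) = mat_trace (mat_adjoint X * (Y * W))"
    using mat_trace_unitary_invariant[OF A B U] by (simp add: X_def BU)
  also have "mat_adjoint X * (Y * W) = (mat_adjoint X * Y) * W"
    using X Y W by (intro assoc_mult_mat[symmetric]) auto
  also have "mat_trace \<dots> = (\<Sum>i<n. \<Sum>j<n. (mat_adjoint X * Y) $$ (i, j) * W $$ (j, i))"
    unfolding mat_trace_def using X Y W
    by (intro sum.cong index_mult_mat_sum[of _ n n _ n]) auto
  also have "\<dots> = (\<Sum>i<n. \<Sum>j<n. of_real (p i) * of_real (q j) * C i j * W $$ (j, i))"
    by (intro sum.cong) (auto simp: XY simp del: index_mult_mat(1))
  finally have "cmod (mat_trace (mat_adjoint A * B)) \<le>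
    (\<Sum>i<n. \<Sum>j<n. cmod (of_real (p i) * of_real (q j) * C i j * W $$ (j, i)))"
    by (simp only:) (intro norm_sum[THEN order_trans] sum_mono order_refl)
  also have "\<dots> \<le> (\<Sum>i<n. \<Sum>j<n. p i * q j * (((cmod (C i j))\<^sup>2 + (cmod (W $$ (j, i)))\<^sup>2) / 2))"
  proof (intro sum_mono)
    fix i j
    have "cmod (C i j) * cmod (W $$ (j, i)) \<le> ((cmod (C i j))\<^sup>2 + (cmod (W $$ (j, i)))\<^sup>2) / 2"
      using sum_squares_bound[of "cmod (C i j)" "cmod (W $$ (j, i))"] by simp
    then have "p i * q j * (cmod (C i j) * cmod (W $$ (j, i))) \<le>
      p i * q j * (((cmod (C i j))\<^sup>2 + (cmod (W $$ (j, i)))\<^sup>2) / 2)"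
      using p(2)[of i] q(2)[of j] by (intro mult_left_mono) auto
    then show "cmod (of_real (p i) * of_real (q j) * C i j * W $$ (j, i)) \<le>
      p i * q j * (((cmod (C i j))\<^sup>2 + (cmod (W $$ (j, i)))\<^sup>2) / 2)"
      using p(2)[of i] q(2)[of j] by (simp add: norm_mult mult.assoc)
  qed
  also have "\<dots> \<le> (\<Sum>i<n. p i * q i)"
  proof (rule substochastic_sum_le)
    fix i assume i: "i < n"
    have "(\<Sum>j<n. (cmod (C i j))\<^sup>2) = (\<Sum>j<n. (cmod (\<Sum>k<m. cnj (b j k) * a i k))\<^sup>2)"
      unfolding C_def by (intro sum.cong refl arg_cong[of _ _ "\<lambda>x. x\<^sup>2"])
        (subst complex_mod_cnj[symmetric], simp add: mult.commute)
    also have "\<dots> \<le> (\<Sum>k<m. (cmod (a i k))\<^sup>2)" by (rule bessel_inequality[OF b(2,3)])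
    also have "\<dots> \<le> 1" by (rule a(3)[OF i])
    finally show "(\<Sum>j<n. ((cmod (C i j))\<^sup>2 + (cmod (W $$ (j, i)))\<^sup>2) / 2) \<le> 1"
      using unitary_row_sums(1)[OF W WW i] by (simp add: sum_divide_distrib[symmetric] sum.distrib)
  next
    fix j assume j: "j < n"
    have "(\<Sum>i<n. (cmod (C i j))\<^sup>2) \<le> (\<Sum>k<m. (cmod (b j k))\<^sup>2)"
      unfolding C_def by (rule bessel_inequality[OF a(2,3)])
    also have "\<dots> \<le> 1" by (rule b(3)[OF j])
    finally show "(\<Sum>i<n. ((cmod (C i j))\<^sup>2 + (cmod (W $$ (j, i)))\<^sup>2) / 2) \<le> 1"
      using unitary_row_sums(2)[OF W WW j] by (simp add: sum_divide_distrib[symmetric] sum.distrib)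
  qed (use p q in auto)
  also have "\<dots> = G_sum r \<sigma> \<tau>"
    using sum_padded_values[OF char_poly_gram(1)[OF A svA], of "\<lambda>i x. x * q i" \<sigma>] rs
    by (auto simp: p_def q_def G_sum_def padded_values_def intro!: sum.cong)
  finally show ?thesis .
qed

section \<open>The lower bound for positive polar factors\<close>

text \<open>Polarization: over the complex numbers the vectors \<open>e\<^sub>a + c e\<^sub>b\<close> with \<open>c\<close> among \<open>0, 1, \<i>\<close> already
determine every entry.\<close>
lemma quadratic_form_eqI:
  fixes K L :: "complex mat"
  assumes K: "K \<in> carrier_mat n n" and L: "L \<in> carrier_mat n n"
    and form: "\<And>v. v \<in> carrier_vec n \<Longrightarrow> (K *\<^sub>v v) \<bullet>c v = (L *\<^sub>v v) \<bullet>c v"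
  shows "K = L"
proof (rule eq_matI)
  fix i j assume "i < dim_row L" "j < dim_col L"
  then have ij: "i < n" "j < n" using L by auto
  define d where "d a b = K $$ (a, b) - L $$ (a, b)" for a b
  have form_sum: "(M *\<^sub>v v) \<bullet>c v = (\<Sum>a<n. \<Sum>b<n. M $$ (a, b) * v $ b * cnj (v $ a))"
    if "M \<in> carrier_mat n n" "v \<in> carrier_vec n" for M and v :: "complex vec"
    using that by (subst cscalar_prod_sum[of _ n])
      (auto simp: mult_mat_vec_def scalar_prod_def atLeast0LessThan sum_distrib_right intro!: sum.cong)
  have zero: "(\<Sum>a<n. \<Sum>b<n. d a b * f b * cnj (f a)) = 0" for f :: "nat \<Rightarrow> complex"
  proof -
    have "(\<Sum>a<n. \<Sum>b<n. d a b * f b * cnj (f a)) =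
      (K *\<^sub>v vec n f) \<bullet>c vec n f - (L *\<^sub>v vec n f) \<bullet>c vec n f"
      by (simp add: form_sum[OF K] form_sum[OF L] d_def left_diff_distrib sum_subtractf)
    then show ?thesis using form[of "vec n f"] by simp
  qed
  have expand: "d a a + c * d a b + cnj c * d b a + cnj c * c * d b b = 0"
    if "a < n" "b < n" for a b and c :: complex
  proof -
    define u where "u k = (if k = a then 1 else 0 :: complex)" for k
    define w where "w k = (if k = b then 1 else 0 :: complex)" for k
    have bil: "(\<Sum>x<n. \<Sum>y<n. d x y * (if y = k then 1 else 0) * (if x = l then 1 else 0)) = d l k"
      if "k < n" "l < n" for k l
    proof -
      have "(\<Sum>x<n. \<Sum>y<n. d x y * (if y = k then 1 else 0) * (if x = l then 1 else 0)) =
        (\<Sum>x<n. \<Sum>y<n. if y = k then (if x = l then d l k else 0) else 0)"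
        by (intro sum.cong) auto
      then show ?thesis using that by simp
    qed
    have "0 = (\<Sum>x<n. \<Sum>y<n. d x y * (u y + c * w y) * cnj (u x + c * w x))"
      by (rule zero[symmetric])
    also have "\<dots> = (\<Sum>x<n. \<Sum>y<n. d x y * u y * u x) + c * (\<Sum>x<n. \<Sum>y<n. d x y * w y * u x)
       + cnj c * (\<Sum>x<n. \<Sum>y<n. d x y * u y * w x) + cnj c * c * (\<Sum>x<n. \<Sum>y<n. d x y * w y * w x)"
    proof -
      have "cnj (u x) = u x" "cnj (w x) = w x" for x by (auto simp: u_def w_def)
      then show ?thesis
        unfolding sum_distrib_left sum.distrib[symmetric]
        by (intro sum.cong refl) (simp add: algebra_simps)
    qed
    finally show ?thesis using that bil unfolding u_def w_def by simp
  qed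
  have "d i i = 0" "d j j = 0" using expand[of i i 0] expand[of j j 0] ij by auto
  with expand[OF ij, of 1] expand[OF ij, of \<i>] have "d i j + d j i = 0" "\<i> * d i j - \<i> * d j i = 0"
    by auto
  then have "d i j = 0" by (simp add: right_diff_distrib[symmetric] eq_neg_iff_add_eq_0[symmetric])
  then show "K $$ (i, j) = L $$ (i, j)" by (simp add: d_def)
qed (use K L in auto)

lemma euclid_norm_squared:
  assumes "v \<in> carrier_vec n"
  shows "v \<bullet>c v = of_real ((euclid_norm v)\<^sup>2)"
proof -
  have "(euclid_norm v)\<^sup>2 = (\<Sum>k<n. (cmod (v $ k))\<^sup>2)"
    using assms by (simp add: euclid_norm_def sum_nonneg)
  then show ?thesis
    unfolding cscalar_prod_sum[OF assms assms] by (simp only: of_real_sum complex_norm_square)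
qed

text \<open>Every \<open>H v\<close> lies in the column space of \<open>H\<close>, on which \<open>Q\<close> is isometric; so \<open>A v\<close> and \<open>H v\<close> have equal norms,
and the quadratic forms of the two Gram matrices agree.\<close>
lemma polar_factor_gram:
  assumes "gen_polar_decomp m n r A Q H"
  shows "H \<in> carrier_mat n n" "mat_adjoint A * A = mat_adjoint H * H"
proof -
  have Q: "Q \<in> carrier_mat m n" and H: "H \<in> carrier_mat n n" and A: "A = Q * H"
    and iso: "\<And>v. v \<in> vec_space.col_space n H \<Longrightarrow> euclid_norm (Q *\<^sub>v v) = euclid_norm v"
    using assms by (auto simp: gen_polar_decomp_def mats_of_rank_def subunitary_def)
  show "H \<in> carrier_mat n n" by (rule H)
  show "mat_adjoint A * A = mat_adjoint H * H"
  proof (rule quadratic_form_eqI)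
    fix v :: "complex vec" assume v: "v \<in> carrier_vec n"
    interpret vec_space "TYPE(complex)" n .
    have "H *\<^sub>v v \<in> col_space H" using H v unfolding col_space_eq[OF H] by auto
    then have "euclid_norm (A *\<^sub>v v) = euclid_norm (H *\<^sub>v v)"
      using iso Q H v by (simp add: A assoc_mult_mat_vec[of _ m n _ n])
    then have "(A *\<^sub>v v) \<bullet>c (A *\<^sub>v v) = (H *\<^sub>v v) \<bullet>c (H *\<^sub>v v)"
      using euclid_norm_squared[of "A *\<^sub>v v" m] euclid_norm_squared[of "H *\<^sub>v v" n] Q H v
      by (simp add: A)
    moreover have "A \<in> carrier_mat m n" using Q H A by simp
    ultimately show "(mat_adjoint A * A *\<^sub>v v) \<bullet>c v = (mat_adjoint H * H *\<^sub>v v) \<bullet>c v"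
      using H v by (simp only: gram_cscalar_prod[of A m n] gram_cscalar_prod[of H n n])
  qed (use Q H A in auto)
qed

text \<open>These bounds carry both halves of the estimate: the upper one applies to the perturbed matrices, the lower one
to their positive polar factors.\<close>
lemma frob_norm_diff_bounds:
  fixes A B :: "complex mat"
  assumes "A \<in> carrier_mat m n" "B \<in> carrier_mat m n"
    and "nonzero_singular_values A = map \<sigma> [1..<Suc r]"
    and "nonzero_singular_values B = map \<tau> [1..<Suc s]"
    and "r \<le> s"
    and "\<forall>j\<in>{1..r}. 0 < \<sigma> j" "\<forall>i\<in>{1..r}. \<forall>j\<in>{1..r}. i \<le> j \<longrightarrow> \<sigma> j \<le> \<sigma> i"
    and "\<forall>j\<in>{1..s}. 0 < \<tau> j" "\<forall>i\<in>{1..s}. \<forall>j\<in>{1..s}. i \<le> j \<longrightarrow> \<tau> j \<le> \<tau> i"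
  shows "F_sum r s \<sigma> \<tau> - 2 * G_sum r \<sigma> \<tau> \<le> (frob_norm (A - B))\<^sup>2"
    and "(frob_norm (A - B))\<^sup>2 \<le> F_sum r s \<sigma> \<tau> + 2 * G_sum r \<sigma> \<tau>"
proof -
  have "\<bar>Re (mat_trace (mat_adjoint A * B))\<bar> \<le> G_sum r \<sigma> \<tau>"
    using von_neumann_trace_inequality[OF assms] abs_Re_le_cmod order_trans by blast
  then show "F_sum r s \<sigma> \<tau> - 2 * G_sum r \<sigma> \<tau> \<le> (frob_norm (A - B))\<^sup>2"
    "(frob_norm (A - B))\<^sup>2 \<le> F_sum r s \<sigma> \<tau> + 2 * G_sum r \<sigma> \<tau>"
    unfolding frob_norm_diff_squared[OF assms(1,2)] F_sum_def
      frob_norm_squared_singular_values[OF assms(1,3)] frob_norm_squared_singular_values[OF assms(2,4)]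
    by linarith+
qed

text \<open>The sign conditions that make the radicand of the coefficient meaningful: \<open>F - 2G\<close> is a sum of
squares, namely of the differences \<open>\<sigma> j - \<tau> j\<close> and of the surplus \<open>\<tau> j\<close>.\<close>
lemma F_sum_G_sum_bounds:
  assumes "1 \<le> r" "r \<le> s" "\<forall>j\<in>{1..r}. 0 < \<sigma> j" "\<forall>j\<in>{1..s}. 0 < \<tau> j"
  shows "0 \<le> F_sum r s \<sigma> \<tau> - 2 * G_sum r \<sigma> \<tau>" "0 < F_sum r s \<sigma> \<tau> + 2 * G_sum r \<sigma> \<tau>"
proof -
  have \<tau>: "(\<Sum>j=1..r. (\<tau> j)\<^sup>2) \<le> (\<Sum>j=1..s. (\<tau> j)\<^sup>2)" using assms by (intro sum_mono2) auto
  have "0 \<le> (\<Sum>j=1..r. (\<sigma> j - \<tau> j)\<^sup>2)" by (simp add: sum_nonneg)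
  also have "\<dots> = (\<Sum>j=1..r. (\<sigma> j)\<^sup>2) + (\<Sum>j=1..r. (\<tau> j)\<^sup>2) - 2 * (\<Sum>j=1..r. \<sigma> j * \<tau> j)"
    by (simp add: power2_diff sum.distrib sum_subtractf sum_distrib_left mult.assoc)
  finally show "0 \<le> F_sum r s \<sigma> \<tau> - 2 * G_sum r \<sigma> \<tau>" using \<tau> by (simp add: F_sum_def G_sum_def)
  have "0 < (\<Sum>j=1..r. (\<sigma> j)\<^sup>2)" using assms by (intro sum_pos zero_less_power) auto
  moreover have "0 \<le> (\<Sum>j=1..s. (\<tau> j)\<^sup>2)" by (simp add: sum_nonneg)
  moreover have "0 \<le> G_sum r \<sigma> \<tau>"
    using assms unfolding G_sum_def by (intro sum_nonneg mult_nonneg_nonneg) (auto simp: less_imp_le)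
  ultimately show "0 < F_sum r s \<sigma> \<tau> + 2 * G_sum r \<sigma> \<tau>" by (simp add: F_sum_def)
qed

lemma positive_polar_factor_lower_bound:
  assumes "1 \<le> r" and rs: "r \<le> s"
    and \<sigma>: "\<forall>j\<in>{1..r}. 0 < \<sigma> j" "\<forall>i\<in>{1..r}. \<forall>j\<in>{1..r}. i \<le> j \<longrightarrow> \<sigma> j \<le> \<sigma> i"
    and \<tau>: "\<forall>j\<in>{1..s}. 0 < \<tau> j" "\<forall>i\<in>{1..s}. \<forall>j\<in>{1..s}. i \<le> j \<longrightarrow> \<tau> j \<le> \<tau> i"
    and A: "A \<in> carrier_mat m n" and A': "A' \<in> carrier_mat m n"
    and polar: "gen_polar_decomp m n r A Q H" "gen_polar_decomp m n s A' Q' H'"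
    and sv: "nonzero_singular_values A = map \<sigma> [1..<Suc r]" "nonzero_singular_values A' = map \<tau> [1..<Suc s]"
  shows "polar_coeff r s \<sigma> \<tau> * frob_norm (A - A') \<le> frob_norm (H - H')"
proof -
  define F where "F = F_sum r s \<sigma> \<tau>"
  define G where "G = G_sum r \<sigma> \<tau>"
  note FG = F_sum_G_sum_bounds[OF assms(1,2) \<sigma>(1) \<tau>(1), folded F_def G_def]
  note H = polar_factor_gram[OF polar(1)] and H' = polar_factor_gram[OF polar(2)]
  have svH: "nonzero_singular_values H = map \<sigma> [1..<Suc r]" "nonzero_singular_values H' = map \<tau> [1..<Suc s]"
    using sv unfolding nonzero_singular_values_def H(2) H'(2) by auto
  have "(frob_norm (A - A'))\<^sup>2 \<le> F + 2 * G"
    unfolding F_def G_def by (rule frob_norm_diff_bounds(2)[OF A A' sv rs \<sigma> \<tau>])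
  then have "(F - 2 * G) / (F + 2 * G) * (frob_norm (A - A'))\<^sup>2 \<le> (F - 2 * G) / (F + 2 * G) * (F + 2 * G)"
    using FG by (intro mult_left_mono) auto
  also have "\<dots> = F - 2 * G" using FG by simp
  also have "\<dots> \<le> (frob_norm (H - H'))\<^sup>2"
    unfolding F_def G_def by (rule frob_norm_diff_bounds(1)[OF H(1) H'(1) svH rs \<sigma> \<tau>])
  finally have "sqrt ((F - 2 * G) / (F + 2 * G) * (frob_norm (A - A'))\<^sup>2) \<le> sqrt ((frob_norm (H - H'))\<^sup>2)"
    by (rule real_sqrt_le_mono)
  moreover have "0 \<le> frob_norm M" for M by (simp add: frob_norm_def sum_nonneg)
  ultimately show ?thesis
    by (simp only: real_sqrt_mult real_sqrt_abs abs_of_nonneg polar_coeff_def F_def G_def)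
qed

section \<open>Rectangular diagonal matrices and optimality\<close>

definition rect_diag :: "nat \<Rightarrow> nat \<Rightarrow> (nat \<Rightarrow> complex) \<Rightarrow> complex mat" where
  "rect_diag m n d = mat m n (\<lambda>(i, j). if i = j then d i else 0)"

lemma rect_diag_carrier [simp]: "rect_diag m n d \<in> carrier_mat m n"
  and dim_rect_diag [simp]: "dim_row (rect_diag m n d) = m" "dim_col (rect_diag m n d) = n"
  and index_rect_diag [simp]: "i < m \<Longrightarrow> j < n \<Longrightarrow> rect_diag m n d $$ (i, j) = (if i = j then d i else 0)"
  by (auto simp: rect_diag_def)

lemma mat_adjoint_rect_diag: "mat_adjoint (rect_diag m n d) = rect_diag n m (\<lambda>i. cnj (d i))"
  by (rule eq_matI) auto

lemma mult_rect_diag: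
  assumes "\<And>i. k \<le> i \<Longrightarrow> d i * e i = 0"
  shows "rect_diag m k d * rect_diag k n e = rect_diag m n (\<lambda>i. d i * e i)"
proof (rule eq_matI)
  fix i j assume "i < dim_row (rect_diag m n (\<lambda>i. d i * e i))" "j < dim_col (rect_diag m n (\<lambda>i. d i * e i))"
  then have ij: "i < m" "j < n" by auto
  have "(rect_diag m k d * rect_diag k n e) $$ (i, j) = (\<Sum>l<k. rect_diag m k d $$ (i, l) * rect_diag k n e $$ (l, j))"
    using ij by (intro index_mult_mat_sum) auto
  also have "\<dots> = (\<Sum>l<k. if l = i then (if i = j then d i * e i else 0) else 0)"
    using ij by (intro sum.cong) auto
  also have "\<dots> = rect_diag m n (\<lambda>i. d i * e i) $$ (i, j)"
    using ij assms[of i] by (auto simp: not_less)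
  finally show "(rect_diag m k d * rect_diag k n e) $$ (i, j) = rect_diag m n (\<lambda>i. d i * e i) $$ (i, j)" .
qed auto

lemma rect_diag_mult_vec:
  assumes "v \<in> carrier_vec n"
  shows "rect_diag m n d *\<^sub>v v = vec m (\<lambda>i. if i < n then d i * v $ i else 0)"
proof (rule eq_vecI)
  fix i assume "i < dim_vec (vec m (\<lambda>i. if i < n then d i * v $ i else 0))"
  then have i: "i < m" by simp
  have "(rect_diag m n d *\<^sub>v v) $ i = (\<Sum>l<n. rect_diag m n d $$ (i, l) * v $ l)"
    using i assms by (auto simp: scalar_prod_def atLeast0LessThan intro!: sum.cong)
  also have "\<dots> = (\<Sum>l<n. if l = i then d i * v $ i else 0)"
    using i by (intro sum.cong) auto
  finally show "(rect_diag m n d *\<^sub>v v) $ i = vec m (\<lambda>i. if i < n then d i * v $ i else 0) $ i"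
    using i by auto
qed auto

lemma col_space_rect_diag:
  assumes r: "r \<le> m" "r \<le> n" and d: "\<And>i. i < r \<Longrightarrow> d i \<noteq> 0" "\<And>i. r \<le> i \<Longrightarrow> d i = 0"
  shows "vec_space.col_space m (rect_diag m n d) = {v \<in> carrier_vec m. \<forall>i<m. r \<le> i \<longrightarrow> v $ i = 0}"
proof -
  interpret vec_space "TYPE(complex)" m .
  have "y = rect_diag m n d *\<^sub>v vec n (\<lambda>i. if i < r then y $ i / d i else 0)"
    if "y \<in> carrier_vec m" "\<forall>i<m. r \<le> i \<longrightarrow> y $ i = 0" for y
    using that r d by (subst rect_diag_mult_vec) (auto intro!: eq_vecI)
  then have "\<exists>x\<in>carrier_vec n. rect_diag m n d *\<^sub>v x = y"
    if "y \<in> carrier_vec m" "\<forall>i<m. r \<le> i \<longrightarrow> y $ i = 0" for y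
    using that by (metis vec_carrier)
  then show ?thesis
    unfolding col_space_eq[OF rect_diag_carrier] using d by (auto simp: rect_diag_mult_vec)
qed

text \<open>The rank depends on the column space alone, which is that of the first \<open>r\<close> unit vectors.\<close>
lemma rank_rect_diag:
  assumes r: "r \<le> m" "r \<le> n" and d: "\<And>i. i < r \<Longrightarrow> d i \<noteq> 0" "\<And>i. r \<le> i \<Longrightarrow> d i = 0"
  shows "rect_diag m n d \<in> mats_of_rank m n r"
proof -
  interpret vec_space "TYPE(complex)" m .
  define P where "P = rect_diag m r (\<lambda>i. if i < r then 1 else 0)"
  have P: "P \<in> carrier_mat m r" by (simp add: P_def)
  have cols: "cols P = map (unit_vec m) [0..<r]"
    using r by (intro nth_equalityI) (auto simp: P_def intro!: eq_vecI)
  have "set (cols P) \<subseteq> set (unit_vecs m)" using r by (auto simp: cols unit_vecs_def)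
  then have "lin_indpt (set (cols P))"
    using unit_vecs_basis subset_li_is_li unfolding basis_def by blast
  moreover have "distinct (cols P)"
    using r unit_vec_eq[of _ m] by (auto simp: cols distinct_map inj_on_def)
  ultimately have "rank P = r" by (intro lin_indpt_full_rank[OF P])
  moreover have "col_space (rect_diag m n d) = col_space P"
    unfolding P_def using r d by (subst (1 2) col_space_rect_diag[of r]) auto
  ultimately show ?thesis by (simp add: mats_of_rank_def rank_def col_space_def)
qed

lemma padded_values_nonzero:
  assumes "\<forall>j\<in>{1..r}. 0 < \<sigma> j" "i < r"
  shows "padded_values r \<sigma> i \<noteq> 0"
proof -
  have "0 < \<sigma> (Suc i)" using assms by simp
  then show ?thesis using assms(2) by (simp add: padded_values_def)
qed

lemma nonzero_singular_values_rect_diag: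
  assumes r: "r \<le> m" "r \<le> n" and d: "\<And>i. cmod (d i) = padded_values r \<sigma> i"
    and \<sigma>: "\<forall>j\<in>{1..r}. 0 < \<sigma> j" "\<forall>i\<in>{1..r}. \<forall>j\<in>{1..r}. i \<le> j \<longrightarrow> \<sigma> j \<le> \<sigma> i"
  shows "nonzero_singular_values (rect_diag m n d) = map \<sigma> [1..<Suc r]"
proof -
  define D where "D = rect_diag n n (\<lambda>i. of_real ((padded_values r \<sigma> i)\<^sup>2))"
  have zero: "d i = 0" if "m \<le> i" for i
    using d[of i] that r by (simp add: padded_values_def)
  have "mat_adjoint (rect_diag m n d) * rect_diag m n d = rect_diag n n (\<lambda>i. cnj (d i) * d i)"
    unfolding mat_adjoint_rect_diag by (rule mult_rect_diag) (simp add: zero)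
  also have "(\<lambda>i. cnj (d i) * d i) = (\<lambda>i. of_real ((padded_values r \<sigma> i)\<^sup>2))"
    by (intro ext) (metis complex_norm_square d mult.commute)
  finally have gram: "mat_adjoint (rect_diag m n d) * rect_diag m n d = D" by (simp add: D_def)
  have "char_poly D = (\<Prod>a\<leftarrow>diag_mat D. [:- a, 1:])"
    by (rule char_poly_upper_triangular[of _ n]) (auto simp: D_def)
  then have "proots (char_poly D) = mset (diag_mat D)" by (simp only: proots_linear_factors)
  also have "diag_mat D = map (\<lambda>i. of_real ((padded_values r \<sigma> i)\<^sup>2)) [0..<n]"
    by (auto simp: diag_mat_def D_def)
  finally have "image_mset (\<lambda>z. sqrt (Re z)) (proots (char_poly D)) =
      mset (map (\<lambda>i. \<bar>padded_values r \<sigma> i\<bar>) [0..<n])"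
    by (simp add: multiset.map_comp comp_def)
  also have "map (\<lambda>i. \<bar>padded_values r \<sigma> i\<bar>) [0..<n] = map (padded_values r \<sigma>) [0..<n]"
    using \<sigma>(1) by (auto simp: padded_values_def intro!: abs_of_pos)
  finally have spectrum: "image_mset (\<lambda>z. sqrt (Re z)) (proots (char_poly D)) =
      mset (map \<sigma> [1..<Suc r]) + replicate_mset (n - r) 0"
    by (simp only: map_padded_values[OF r(2)] mset_append mset_replicate)
  have "filter (\<lambda>x. x \<noteq> 0) (map \<sigma> [1..<Suc r]) = map \<sigma> [1..<Suc r]"
    using \<sigma>(1) by (intro filter_True) (force simp del: upt_Suc)
  then have "filter_mset (\<lambda>x. x \<noteq> 0) (mset (map \<sigma> [1..<Suc r])) = mset (map \<sigma> [1..<Suc r])"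
    by (simp only: mset_filter[symmetric])
  with spectrum have filt: "filter_mset (\<lambda>x. x \<noteq> 0) (image_mset (\<lambda>z. sqrt (Re z)) (proots (char_poly D))) =
      mset (map \<sigma> [1..<Suc r])"
    by (simp del: upt_Suc)
  have "sorted_wrt (\<lambda>x y. y \<le> x) (map \<sigma> [1..<Suc r])"
    using \<sigma>(2) by (auto simp: sorted_wrt_iff_nth_less simp del: upt_Suc)
  then have "sorted (rev (map \<sigma> [1..<Suc r]))" by (simp only: sorted_wrt_rev)
  then have "sort (map \<sigma> [1..<Suc r]) = rev (map \<sigma> [1..<Suc r])"
    by (intro properties_for_sort) simp_all
  then show ?thesis
    unfolding nonzero_singular_values_def gram filt sorted_list_of_multiset_mset by (simp only: rev_rev_ident)
qed

text \<open>The phase \<open>e\<close> goes entirely into the subunitary factor, so the positive factor does not depend on it.\<close>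
lemma gen_polar_decomp_rect_diag:
  assumes r: "r \<le> m" "r \<le> n" and \<sigma>: "\<forall>j\<in>{1..r}. 0 < \<sigma> j" and e: "cmod e = 1"
  shows "gen_polar_decomp m n r (rect_diag m n (\<lambda>i. e * of_real (padded_values r \<sigma> i)))
    (rect_diag m n (\<lambda>i. if i < r then e else 0)) (rect_diag n n (\<lambda>i. of_real (padded_values r \<sigma> i)))"
proof -
  let ?Q = "rect_diag m n (\<lambda>i. if i < r then e else 0)"
  let ?H = "rect_diag n n (\<lambda>i. of_real (padded_values r \<sigma> i))"
  have p: "padded_values r \<sigma> i \<noteq> 0" if "i < r" for i
    using padded_values_nonzero[OF _ that] \<sigma> by blast
  have p0: "padded_values r \<sigma> i = 0" if "r \<le> i" for i using that by (simp add: padded_values_def)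
  have p_nonneg: "0 \<le> padded_values r \<sigma> i" for i using \<sigma> by (auto simp: padded_values_def less_imp_le)
  have e0: "e \<noteq> 0" using e by auto
  have adjQ: "mat_adjoint ?Q = rect_diag n m (\<lambda>i. if i < r then cnj e else 0)"
    unfolding mat_adjoint_rect_diag by (rule arg_cong[of _ _ "rect_diag n m"]) auto
  have colQ: "vec_space.col_space n (mat_adjoint ?Q) = {v \<in> carrier_vec n. \<forall>i<n. r \<le> i \<longrightarrow> v $ i = 0}"
    unfolding adjQ using r e0 by (intro col_space_rect_diag) auto
  have colH: "vec_space.col_space n ?H = {v \<in> carrier_vec n. \<forall>i<n. r \<le> i \<longrightarrow> v $ i = 0}"
    using r p p0 by (intro col_space_rect_diag) auto
  have prod: "?Q * ?H = rect_diag m n (\<lambda>i. e * of_real (padded_values r \<sigma> i))"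
  proof -
    have "?Q * ?H = rect_diag m n (\<lambda>i. (if i < r then e else 0) * of_real (padded_values r \<sigma> i))"
      using r p0 by (intro mult_rect_diag) auto
    also have "(\<lambda>i. (if i < r then e else 0) * of_real (padded_values r \<sigma> i)) =
        (\<lambda>i. e * complex_of_real (padded_values r \<sigma> i))"
      using p0 by auto
    finally show ?thesis .
  qed
  have "subunitary m n ?Q"
    unfolding subunitary_def colQ
  proof (intro conjI ballI)
    fix v :: "complex vec" assume "v \<in> {v \<in> carrier_vec n. \<forall>i<n. r \<le> i \<longrightarrow> v $ i = 0}"
    then have v: "v \<in> carrier_vec n" "\<And>i. i < n \<Longrightarrow> r \<le> i \<Longrightarrow> v $ i = 0" by auto
    have "(\<Sum>i<m. (cmod ((?Q *\<^sub>v v) $ i))\<^sup>2) = (\<Sum>i<r. (cmod (v $ i))\<^sup>2)"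
      using r v e by (intro sum.mono_neutral_cong_right) (auto simp: rect_diag_mult_vec norm_mult split: if_splits)
    moreover have "(\<Sum>i<n. (cmod (v $ i))\<^sup>2) = (\<Sum>i<r. (cmod (v $ i))\<^sup>2)"
      using r v by (intro sum.mono_neutral_cong_right) auto
    ultimately show "euclid_norm (?Q *\<^sub>v v) = euclid_norm v"
      using v by (simp add: euclid_norm_def)
  qed simp
  moreover have "pos_semidef n ?H"
    unfolding pos_semidef_def
  proof (intro conjI ballI)
    fix v :: "complex vec" assume v: "v \<in> carrier_vec n"
    have "(?H *\<^sub>v v) \<bullet>c v = (\<Sum>i<n. of_real (padded_values r \<sigma> i * (cmod (v $ i))\<^sup>2))"
      using v by (subst cscalar_prod_sum[of _ n]) (auto simp: rect_diag_mult_vec mult.assoc complex_norm_square simp del: of_real_power intro!: sum.cong)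
    also have "\<dots> = of_real (\<Sum>i<n. padded_values r \<sigma> i * (cmod (v $ i))\<^sup>2)" by simp
    finally show "0 \<le> (?H *\<^sub>v v) \<bullet>c v"
      using p_nonneg by (simp add: less_eq_complex_def sum_nonneg del: of_real_sum)
  qed (simp_all add: mat_adjoint_rect_diag)
  moreover have "?Q \<in> mats_of_rank m n r" using r e0 by (intro rank_rect_diag) auto
  moreover have "?H \<in> mats_of_rank n n r" using r p p0 by (intro rank_rect_diag) auto
  ultimately show ?thesis unfolding gen_polar_decomp_def using prod colQ colH by simp
qed

lemma mat_trace_rect_diag:
  assumes "r \<le> m" "r \<le> n" "\<And>i. r \<le> i \<Longrightarrow> d i = 0"
  shows "mat_trace (mat_adjoint (rect_diag m n d) * rect_diag m n e) = (\<Sum>i<r. cnj (d i) * e i)"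
proof -
  have "mat_adjoint (rect_diag m n d) * rect_diag m n e = rect_diag n n (\<lambda>i. cnj (d i) * e i)"
    unfolding mat_adjoint_rect_diag using assms by (intro mult_rect_diag) auto
  then have "mat_trace (mat_adjoint (rect_diag m n d) * rect_diag m n e) = (\<Sum>i<n. cnj (d i) * e i)"
    by (simp add: mat_trace_def)
  also have "\<dots> = (\<Sum>i<r. cnj (d i) * e i)" using assms by (intro sum.mono_neutral_right) auto
  finally show ?thesis .
qed

text \<open>Opposite phases make the trace of \<open>A\<^sup>* A'\<close> equal to \<open>-G\<close>, while the positive factors are aligned and give
\<open>+G\<close>: both norm bounds become equalities.\<close>
theorem extremal_pair:
  fixes \<sigma> \<tau> :: "nat \<Rightarrow> real"
  assumes r1: "1 \<le> r" and rs: "r \<le> s" and smn: "s \<le> m" "s \<le> n"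
    and \<sigma>: "\<forall>j\<in>{1..r}. 0 < \<sigma> j" "\<forall>i\<in>{1..r}. \<forall>j\<in>{1..r}. i \<le> j \<longrightarrow> \<sigma> j \<le> \<sigma> i"
    and \<tau>: "\<forall>j\<in>{1..s}. 0 < \<tau> j" "\<forall>i\<in>{1..s}. \<forall>j\<in>{1..s}. i \<le> j \<longrightarrow> \<tau> j \<le> \<tau> i"
  obtains A A' Q Q' H H' where
    "A \<in> mats_of_rank m n r" "A' \<in> mats_of_rank m n s"
    "gen_polar_decomp m n r A Q H" "gen_polar_decomp m n s A' Q' H'"
    "nonzero_singular_values A = map \<sigma> [1..<Suc r]" "nonzero_singular_values A' = map \<tau> [1..<Suc s]"
    "0 < frob_norm (A - A')" "frob_norm (H - H') = polar_coeff r s \<sigma> \<tau> * frob_norm (A - A')"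
proof -
  let ?p = "\<lambda>i. complex_of_real (padded_values r \<sigma> i)"
  let ?q = "\<lambda>i. complex_of_real (padded_values s \<tau> i)"
  define A where "A = rect_diag m n (\<lambda>i. 1 * ?p i)"
  define A' where "A' = rect_diag m n (\<lambda>i. - 1 * ?q i)"
  define H where "H = rect_diag n n ?p"
  define H' where "H' = rect_diag n n ?q"
  define F where "F = F_sum r s \<sigma> \<tau>"
  define G where "G = G_sum r \<sigma> \<tau>"
  have rmn: "r \<le> m" "r \<le> n" using rs smn by auto
  have A: "A \<in> carrier_mat m n" and A': "A' \<in> carrier_mat m n"
    and H: "H \<in> carrier_mat n n" and H': "H' \<in> carrier_mat n n"
    by (auto simp: A_def A'_def H_def H'_def)
  have p: "padded_values r \<sigma> i \<noteq> 0" if "i < r" for i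
    using padded_values_nonzero[OF _ that] \<sigma> by blast
  have p0: "padded_values r \<sigma> i = 0" if "r \<le> i" for i using that by (simp add: padded_values_def)
  have q: "padded_values s \<tau> i \<noteq> 0" if "i < s" for i
    using padded_values_nonzero[OF _ that] \<tau> by blast
  have q0: "padded_values s \<tau> i = 0" if "s \<le> i" for i using that by (simp add: padded_values_def)
  have nonneg: "0 \<le> padded_values r \<sigma> i" "0 \<le> padded_values s \<tau> i" for i
    using \<sigma> \<tau> by (auto simp: padded_values_def less_imp_le)
  have rank: "A \<in> mats_of_rank m n r" "A' \<in> mats_of_rank m n s"
    unfolding A_def A'_def using rmn smn p p0 q q0 by (auto intro!: rank_rect_diag)
  have polar: "gen_polar_decomp m n r A (rect_diag m n (\<lambda>i. if i < r then 1 else 0)) H"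
    "gen_polar_decomp m n s A' (rect_diag m n (\<lambda>i. if i < s then - 1 else 0)) H'"
    unfolding A_def A'_def H_def H'_def using rmn smn \<sigma>(1) \<tau>(1)
    by (intro gen_polar_decomp_rect_diag; simp)+
  have sv: "nonzero_singular_values A = map \<sigma> [1..<Suc r]" "nonzero_singular_values A' = map \<tau> [1..<Suc s]"
    unfolding A_def A'_def
    by (rule nonzero_singular_values_rect_diag[OF rmn _ \<sigma>], simp add: norm_mult nonneg)
      (rule nonzero_singular_values_rect_diag[OF smn _ \<tau>], simp add: norm_mult nonneg)
  have svH: "nonzero_singular_values H = map \<sigma> [1..<Suc r]" "nonzero_singular_values H' = map \<tau> [1..<Suc s]"
    unfolding H_def H'_def
    by (rule nonzero_singular_values_rect_diag[OF rmn(2,2) _ \<sigma>], simp add: nonneg)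
      (rule nonzero_singular_values_rect_diag[OF smn(2,2) _ \<tau>], simp add: nonneg)
  have G: "(\<Sum>i<r. padded_values r \<sigma> i * padded_values s \<tau> i) = G"
    using sum_padded_values[OF order_refl, of "\<lambda>i x. x * padded_values s \<tau> i" r \<sigma>] rs
    by (auto simp: G_def G_sum_def padded_values_def intro!: sum.cong)
  have "mat_trace (mat_adjoint A * A') = (\<Sum>i<r. cnj (1 * ?p i) * (- 1 * ?q i))"
    unfolding A_def A'_def using rmn p0 by (intro mat_trace_rect_diag) auto
  also have "\<dots> = of_real (- (\<Sum>i<r. padded_values r \<sigma> i * padded_values s \<tau> i))"
    by (simp add: sum_negf)
  finally have E: "(frob_norm (A - A'))\<^sup>2 = F + 2 * G"
    unfolding frob_norm_diff_squared[OF A A'] frob_norm_squared_singular_values[OF A sv(1)]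
      frob_norm_squared_singular_values[OF A' sv(2)] F_def F_sum_def G by simp
  have "mat_trace (mat_adjoint H * H') = (\<Sum>i<r. cnj (?p i) * ?q i)"
    unfolding H_def H'_def using rmn p0 by (intro mat_trace_rect_diag) auto
  also have "\<dots> = of_real (\<Sum>i<r. padded_values r \<sigma> i * padded_values s \<tau> i)" by simp
  finally have HH: "(frob_norm (H - H'))\<^sup>2 = F - 2 * G"
    unfolding frob_norm_diff_squared[OF H H'] frob_norm_squared_singular_values[OF H svH(1)]
      frob_norm_squared_singular_values[OF H' svH(2)] F_def F_sum_def G by simp
  note FG = F_sum_G_sum_bounds[OF r1 rs \<sigma>(1) \<tau>(1), folded F_def G_def]
  have E': "frob_norm (A - A') = sqrt (F + 2 * G)" and HH': "frob_norm (H - H') = sqrt (F - 2 * G)"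
    using real_sqrt_unique[OF E frob_norm_nonneg] real_sqrt_unique[OF HH frob_norm_nonneg] by simp_all
  show ?thesis
  proof (rule that[OF rank polar sv])
    show "0 < frob_norm (A - A')" using FG by (simp add: E')
    show "frob_norm (H - H') = polar_coeff r s \<sigma> \<tau> * frob_norm (A - A')"
      using FG unfolding E' HH' polar_coeff_def F_def[symmetric] G_def[symmetric] by (simp add: real_sqrt_divide)
  qed
qed

theorem theorem1p10:
  fixes m n r s :: nat and \<sigma> \<tau> :: "nat \<Rightarrow> real"
  assumes "1 \<le> r" and "r \<le> s"
    and "\<forall>j\<in>{1..r}. 0 < \<sigma> j" and "\<forall>i\<in>{1..r}. \<forall>j\<in>{1..r}. i \<le> j \<longrightarrow> \<sigma> j \<le> \<sigma> i"
    and "\<forall>j\<in>{1..s}. 0 < \<tau> j" and "\<forall>i\<in>{1..s}. \<forall>j\<in>{1..s}. i \<le> j \<longrightarrow> \<tau> j \<le> \<tau> i"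
  shows
    "(\<forall>A A' E Q H Q' H'.
        A \<in> mats_of_rank m n r \<and> E \<in> carrier_mat m n \<and> A' = A + E \<and> A' \<in> mats_of_rank m n s \<and>
        gen_polar_decomp m n r A Q H \<and> gen_polar_decomp m n s A' Q' H' \<and>
        nonzero_singular_values A = map \<sigma> [1..<Suc r] \<and>
        nonzero_singular_values A' = map \<tau> [1..<Suc s]
        \<longrightarrow> frob_norm (H - H') \<ge> polar_coeff r s \<sigma> \<tau> * frob_norm E)
     \<and>
     (s \<le> min m n \<longrightarrow>
       (\<forall>c > polar_coeff r s \<sigma> \<tau>.
         \<not> (\<forall>A A' E Q H Q' H'.
              A \<in> mats_of_rank m n r \<and> E \<in> carrier_mat m n \<and> A' = A + E \<and> A' \<in> mats_of_rank m n s \<and>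
              gen_polar_decomp m n r A Q H \<and> gen_polar_decomp m n s A' Q' H' \<and>
              nonzero_singular_values A = map \<sigma> [1..<Suc r] \<and>
              nonzero_singular_values A' = map \<tau> [1..<Suc s]
              \<longrightarrow> frob_norm (H - H') \<ge> c * frob_norm E)))"
proof (intro conjI allI impI notI)
  fix A A' E Q H Q' H'
  assume hyps: "A \<in> mats_of_rank m n r \<and> E \<in> carrier_mat m n \<and> A' = A + E \<and> A' \<in> mats_of_rank m n s \<and>
    gen_polar_decomp m n r A Q H \<and> gen_polar_decomp m n s A' Q' H' \<and>
    nonzero_singular_values A = map \<sigma> [1..<Suc r] \<and>
    nonzero_singular_values A' = map \<tau> [1..<Suc s]"
  then have A: "A \<in> carrier_mat m n" "A' \<in> carrier_mat m n" and E: "E \<in> carrier_mat m n" "A' = A + E"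
    by (auto simp: mats_of_rank_def)
  have "frob_norm (A - A') = frob_norm E"
    using A E by (auto simp: frob_norm_def)
  then show "polar_coeff r s \<sigma> \<tau> * frob_norm E \<le> frob_norm (H - H')"
    using positive_polar_factor_lower_bound[OF assms A] hyps by metis
next
  fix c
  assume "s \<le> min m n" and c: "polar_coeff r s \<sigma> \<tau> < c"
    and all: "\<forall>A A' E Q H Q' H'.
      A \<in> mats_of_rank m n r \<and> E \<in> carrier_mat m n \<and> A' = A + E \<and> A' \<in> mats_of_rank m n s \<and>
      gen_polar_decomp m n r A Q H \<and> gen_polar_decomp m n s A' Q' H' \<and>
      nonzero_singular_values A = map \<sigma> [1..<Suc r] \<and>
      nonzero_singular_values A' = map \<tau> [1..<Suc s]
      \<longrightarrow> frob_norm (H - H') \<ge> c * frob_norm E"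
  then have smn: "s \<le> m" "s \<le> n" by auto
  obtain A A' Q Q' H H' where pair: "A \<in> mats_of_rank m n r" "A' \<in> mats_of_rank m n s"
    "gen_polar_decomp m n r A Q H" "gen_polar_decomp m n s A' Q' H'"
    "nonzero_singular_values A = map \<sigma> [1..<Suc r]" "nonzero_singular_values A' = map \<tau> [1..<Suc s]"
    "0 < frob_norm (A - A')" "frob_norm (H - H') = polar_coeff r s \<sigma> \<tau> * frob_norm (A - A')"
    by (rule extremal_pair[OF assms(1,2) smn assms(3-6)])
  then have A: "A \<in> carrier_mat m n" "A' \<in> carrier_mat m n" by (auto simp: mats_of_rank_def)
  have "A' - A \<in> carrier_mat m n" "A' = A + (A' - A)" using A by auto
  with pair(1-6) have "c * frob_norm (A' - A) \<le> frob_norm (H - H')"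
    by (intro all[rule_format, of A "A' - A" A' Q H Q' H'] conjI)
  moreover have "frob_norm (A' - A) = frob_norm (A - A')"
    using A by (simp add: frob_norm_def norm_minus_commute)
  ultimately have "c * frob_norm (A - A') \<le> polar_coeff r s \<sigma> \<tau> * frob_norm (A - A')"
    using pair(8) by simp
  then show False using c pair(7) by simp
qed

end
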